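(* Let $q$ be a prime power, let $S\subseteq\mathbb F_q^n$ be nonempty, let $1\le b\le n$, $0<\tau\le1$, and $0<\delta<1$, and put $\mu=|S|/q^b$. If there is an integer $a\ge1$ such that $$q^{a-1}\ge16(b+a)\qquad\text{and}\qquad \mu\ge\frac{192\,q^a}{\tau^2\delta},$$ then $\beta_S(b,\tau)<\delta$, and moreover a uniformly random $b\times n$ matrix over $\mathbb F_q$ (not only a uniformly random surjection) is $\tau$-unbalanced with probability less than $\delta$. In particular, for each fixed prime power $q$ there is a constant $C_q$, depending only on $q$ (independent of $n,b,\tau,\delta$), such that these same two conclusions hold for all such $n,S,b,\tau,\delta$ whenever $$\mu\ge\frac{C_q\,b}{\tau^2\delta}.$$
   Context: Let $S\subseteq\mathbb F_q^n$ be nonempty and $\mu=|S|/q^b$. A linear map $L:\mathbb F_q^n\to\mathbb F_q^b$ (equivalently a $b\times n$ matrix over $\mathbb F_q$, not necessarily of full rank) is called $\tau$-balanced (with respect to $S$) if $(1-\tau)\mu\le|S\cap L^{-1}(y)|\le(1+\tau)\mu$ for every $y\in\mathbb F_q^b$, and $\tau$-unbalanced otherwise. $\beta_S(b,\tau)$ denotes the proportion of $\tau$-unbalanced maps among all surjective linear maps $\mathbb F_q^n\to\mathbb F_q^b$. *)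

theory Defs
  imports
    "HOL-Probability.Probability_Mass_Function"
    "Jordan_Normal_Form.Matrix"
begin

text \<open>
  The field with \<open>q\<close> elements is a type \<open>'a\<close> of class \<^class>\<open>field\<close> and \<^class>\<open>finite\<close>, and
  \<open>q\<close> is \<open>CARD('a)\<close>.  The space \<open>F_q^n\<close> is \<^term>\<open>carrier_vec n\<close>, and a linear map from \<open>F_q^n\<close>
  to \<open>F_q^b\<close> is given by its matrix \<open>A \<in> carrier_mat b n\<close>, acting by \<open>x \<mapsto> A *\<^sub>v x\<close>.
\<close>

definition mean_fibre :: "nat \<Rightarrow> 'a::{field,finite} vec set \<Rightarrow> real" where
  "mean_fibre b S = real (card S) / real CARD('a) ^ b"

definition balanced :: "nat \<Rightarrow> 'a::{field,finite} vec set \<Rightarrow> real \<Rightarrow> 'a mat \<Rightarrow> bool" where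
  "balanced b S \<tau> A \<longleftrightarrow>
     (\<forall>y \<in> carrier_vec b.
        (1 - \<tau>) * mean_fibre b S \<le> real (card (S \<inter> {x. A *\<^sub>v x = y})) \<and>
        real (card (S \<inter> {x. A *\<^sub>v x = y})) \<le> (1 + \<tau>) * mean_fibre b S)"

definition surjections :: "nat \<Rightarrow> nat \<Rightarrow> 'a::field mat set" where
  "surjections b n =
     {A \<in> carrier_mat b n. (\<lambda>x. A *\<^sub>v x) ` carrier_vec n = carrier_vec b}"

definition unbalanced_proportion ::
    "nat \<Rightarrow> 'a::{field,finite} vec set \<Rightarrow> nat \<Rightarrow> real \<Rightarrow> real" where
  "unbalanced_proportion n S b \<tau> =
     real (card {A \<in> surjections b n. \<not> balanced b S \<tau> A}) /
     real (card (surjections b n :: 'a mat set))"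

end

theory Submission
  imports Defs "HOL-Computational_Algebra.Polynomial" "HOL-Library.FuncSet"
begin

text \<open>
  Write \<open>q\<close> for the size of the field, \<open>N = a + b\<close>, \<open>\<mu>\<close> for the mean fibre size and
  \<open>\<nu> = \<mu> / q^a\<close>.  Call a map \<open>L\<close> far when one of its fibres on \<open>S\<close> deviates from \<open>\<mu>\<close> by at
  least \<open>\<tau> \<mu>\<close>.  Unbalanced maps are far, and so are maps that are not surjective, because
  they have an empty fibre.  So it is enough that a uniformly random matrix is far with
  probability less than \<open>\<delta>\<close>: passing to surjections removes the same number of matrices from the
  far ones and from all matrices, which can only lower a proportion that is below 1.

  A union bound over the \<open>q^b\<close> fibres is far too expensive.  Instead, refine \<open>L\<close> by a second
  random map \<open>H\<close> to \<open>F_q^a\<close>.  If one fibre of \<open>L\<close> has the wrong size, then by a second moment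
  computation \<open>H\<close> usually splits it into \<open>q^a\<close> cells at least half of which have the wrong size
  compared with \<open>\<nu>\<close> (\<open>sum_card_near_cells\<close>).  On the other hand, put \<open>Y = L + B H\<close> for a random
  matrix \<open>B\<close>.  Then \<open>(H, Y)\<close> is a uniformly random map to \<open>F_q^N\<close> independent of \<open>B\<close>, and the
  same second moment computation shows that it has few wrong cells altogether
  (\<open>sum_card_off_cells\<close>).  Let \<open>D\<close> be the set of the wrong cells of \<open>(H, Y)\<close>.  The cells in the
  fibre of \<open>L\<close> over \<open>z\<close> are the points \<open>(h, z + B h)\<close>, a translate of the subspace
  \<open>{(h, B h)}\<close>.  So a far \<open>L\<close> usually makes \<open>B\<close> rich for \<open>D\<close>: some translate of its subspace lies
  in \<open>D\<close> for at least half of its points.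

  Hence everything reduces to a maximal inequality of Kakeya type
  (\<open>kakeya_maximal_shears\<close>): the proportion of the \<open>B\<close> that are rich for \<open>D\<close> is at most 40 times
  the density of \<open>D\<close>.  It is enough to show that at most a quarter of the \<open>B\<close> are rich for a set
  of density at most \<open>1/20\<close> (\<open>kakeya_for_shears\<close>).  For a sparser \<open>D\<close> this is applied to the
  union of many images of \<open>D\<close> under shears \<open>(h, y) \<mapsto> (h, y + C h)\<close>; these translate the set of
  rich \<open>B\<close> by \<open>C\<close>, so that well chosen \<open>C\<close> make the translates cover much.

  The Kakeya statement is proved by the polynomial method with multiplicities.  There is a
  nonzero polynomial \<open>P\<close> of degree at most \<open>4 q N\<^sup>2\<close> that vanishes to order about \<open>4 N\<^sup>2\<close> at
  every point of \<open>F_q^N\<close>, to a slightly higher order on \<open>D\<close> and to a slightly lower one off \<open>D\<close>.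
  On a translate that is half contained in \<open>D\<close> the average order exceeds \<open>4 N\<^sup>2\<close> by \<open>N\<close>, and
  the Schwartz-Zippel lemma with multiplicities shows that all derivatives of \<open>P\<close> of order less
  than \<open>N\<close> vanish identically there.  Therefore the top homogeneous part of \<open>P\<close> vanishes to order
  \<open>N\<close> along \<open>{(t, B t)}\<close> for indeterminate \<open>t\<close>.  When the entries of \<open>t\<close> are powers of the
  variable \<open>X\<close> of \<open>F_q[X]\<close>, the points \<open>B t\<close> range over a grid \<open>T^b\<close> with \<open>T\<close> a set of \<open>q^a\<close>
  elements of \<open>F_q[X]\<close>, and a second application of Schwartz-Zippel bounds the number of rich
  \<open>B\<close>.  This is why \<open>q^(a-1)\<close> is compared with \<open>N\<close>: the polynomial has degree about
  \<open>4 q N\<^sup>2\<close>, and the grid has side \<open>q^a\<close> and multiplicity \<open>N\<close>.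

  Such an \<open>a\<close> exists with \<open>q^a\<close> at most a constant times \<open>b\<close>, the constant depending only on \<open>q\<close>
  (\<open>ex_extra_dimension\<close>), and this gives the bound on \<open>\<mu>\<close> that is linear in \<open>b\<close>.
\<close>

section \<open>Hasse derivatives\<close>

text \<open>
  A polynomial in the variables \<open>J\<close> is given by its coefficient function \<open>c\<close> on exponent
  vectors.  The range of exponents is a box and not a simplex, because products of sums over single
  exponents expand over a box; the total degree is controlled separately by
  \<open>total_degree_le\<close>.
\<close>

definition exponent_box :: "'i set \<Rightarrow> nat \<Rightarrow> ('i \<Rightarrow> nat) set" where
  "exponent_box J d = PiE J (\<lambda>_. {..d})"

text \<open>
  The \<open>i\<close>-th divided derivative of the polynomial \<open>c\<close> at \<open>x\<close>, that is, the coefficient of \<open>w^i\<close>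
  in the expansion of its value at \<open>x + w\<close>.  Unlike iterated derivatives, these coefficients detect
  the vanishing order in positive characteristic.  For \<open>i = 0\<close> it is the value at \<open>x\<close>.
\<close>

definition hasse :: "'i set \<Rightarrow> nat \<Rightarrow> (('i \<Rightarrow> nat) \<Rightarrow> 'r) \<Rightarrow> ('i \<Rightarrow> nat) \<Rightarrow> ('i \<Rightarrow> 'r) \<Rightarrow> 'r::comm_ring_1"
  where "hasse J d c i x =
    (\<Sum>e\<in>exponent_box J d. c e * (\<Prod>k\<in>J. of_nat (e k choose i k) * x k ^ (e k - i k)))"

definition total_degree_le :: "'i set \<Rightarrow> nat \<Rightarrow> (('i \<Rightarrow> nat) \<Rightarrow> 'r::zero) \<Rightarrow> nat \<Rightarrow> bool" where
  "total_degree_le J d c k \<longleftrightarrow> (\<forall>e\<in>exponent_box J d. c e \<noteq> 0 \<longrightarrow> sum e J \<le> k)"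

lemma sum_fun_upd_insert:
  assumes "finite J" "p \<notin> J"
  shows "sum (f(p := j)) (insert p J) = j + sum f J"
proof -
  have "sum (f(p := j)) J = sum f J"
    using assms(2) by (intro sum.cong) auto
  then show ?thesis using assms by simp
qed

lemma finite_box [simp, intro]: "finite J \<Longrightarrow> finite (exponent_box J d)"
  by (auto simp: exponent_box_def intro!: finite_PiE)

lemma hasse_cong:
  assumes "\<And>e. e \<in> exponent_box J d \<Longrightarrow> c e = c' e" "\<And>k. k \<in> J \<Longrightarrow> i k = i' k" "\<And>k. k \<in> J \<Longrightarrow> x k = x' k"
  shows "hasse J d c i x = hasse J d c' i' x'"
  unfolding hasse_def by (intro sum.cong prod.cong refl arg_cong2[of _ _ _ _ "(*)"])
    (use assms in auto)

lemma prod_binomial_eq_0: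
  assumes "finite J" "k \<in> J" "e k < i k"
  shows "(\<Prod>k\<in>J. of_nat (e k choose i k) * f k) = (0 :: 'r::comm_ring_1)"
proof -
  have "of_nat (e k choose i k) * f k = 0"
    using assms(3) by (simp add: binomial_eq_0)
  then show ?thesis using assms(1,2) by (intro prod_zero) blast+
qed

lemma choose_add_mult:
  "(i + j choose j) * (e choose (i + j)) = (e choose i) * (e - i choose j)"
proof (cases "i + j \<le> e")
  case True
  then show ?thesis
    using choose_mult[of i "i + j" e] by (simp add: mult.commute binomial_symmetric[of j "i+j"])
next
  case False
  then show ?thesis by (cases "i \<le> e") (auto simp: binomial_eq_0)
qed

lemma hasse_taylor_single:
  fixes x w :: "'r::comm_ring_1"
  assumes "e \<le> d"
  shows "of_nat (e choose i) * (x + w) ^ (e - i) =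
    (\<Sum>j\<le>d. of_nat (i + j choose j) * (of_nat (e choose (i + j)) * x ^ (e - (i + j))) * w ^ j)"
proof -
  have "(x + w) ^ (e - i) = (\<Sum>j\<le>e - i. of_nat (e - i choose j) * w ^ j * x ^ (e - i - j))"
    by (subst add.commute) (rule binomial_ring)
  also have "\<dots> = (\<Sum>j\<le>d. of_nat (e - i choose j) * w ^ j * x ^ (e - i - j))"
    using assms by (intro sum.mono_neutral_left) (auto simp: binomial_eq_0)
  finally have "of_nat (e choose i) * (x + w) ^ (e - i) =
     (\<Sum>j\<le>d. of_nat ((e choose i) * (e - i choose j)) * w ^ j * x ^ (e - i - j))"
    by (simp add: sum_distrib_left mult_ac)
  also have "\<dots> = (\<Sum>j\<le>d. of_nat (i + j choose j) * (of_nat (e choose (i + j)) * x ^ (e - (i + j))) * w ^ j)"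
    by (intro sum.cong refl) (simp add: choose_add_mult[symmetric] mult_ac)
  finally show ?thesis .
qed

text \<open>
  Taylor expansion of a Hasse derivative.  The binomial factor is the usual one that
  relates the \<open>j\<close>-th derivative of the \<open>i\<close>-th derivative to the \<open>(i + j)\<close>-th derivative.  Monomials
  are products over the coordinates, so the expansion is a product of one-variable expansions.
\<close>

lemma hasse_taylor:
  fixes x w :: "'i \<Rightarrow> 'r::comm_ring_1"
  assumes "finite J"
  shows "hasse J d c i (\<lambda>k. x k + w k) =
    (\<Sum>j\<in>exponent_box J d. (\<Prod>k\<in>J. of_nat (i k + j k choose j k)) *
        hasse J d c (\<lambda>k. i k + j k) x * (\<Prod>k\<in>J. w k ^ j k))"
proof -
  have "hasse J d c i (\<lambda>k. x k + w k) = (\<Sum>e\<in>exponent_box J d. c e * (\<Sum>j\<in>exponent_box J d. \<Prod>k\<in>J.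
      of_nat (i k + j k choose j k) * (of_nat (e k choose (i k + j k)) * x k ^ (e k - (i k + j k))) * w k ^ j k))"
    unfolding hasse_def
  proof (intro sum.cong refl arg_cong2[of _ _ _ _ "(*)"])
    fix e assume e: "e \<in> exponent_box J d"
    have "(\<Prod>k\<in>J. of_nat (e k choose i k) * (x k + w k) ^ (e k - i k)) =
      (\<Prod>k\<in>J. \<Sum>j\<le>d. of_nat (i k + j choose j) * (of_nat (e k choose (i k + j)) * x k ^ (e k - (i k + j))) * w k ^ j)"
      using e by (intro prod.cong refl hasse_taylor_single) (auto simp: exponent_box_def)
    also have "\<dots> = (\<Sum>j\<in>exponent_box J d. \<Prod>k\<in>J.
      of_nat (i k + j k choose j k) * (of_nat (e k choose (i k + j k)) * x k ^ (e k - (i k + j k))) * w k ^ j k)"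
      unfolding exponent_box_def using assms by (intro prod_sum_PiE) auto
    finally show "(\<Prod>k\<in>J. of_nat (e k choose i k) * (x k + w k) ^ (e k - i k)) = \<dots>" .
  qed
  also have "\<dots> = (\<Sum>j\<in>exponent_box J d. \<Sum>e\<in>exponent_box J d. c e * (\<Prod>k\<in>J.
      of_nat (i k + j k choose j k) * (of_nat (e k choose (i k + j k)) * x k ^ (e k - (i k + j k))) * w k ^ j k))"
    unfolding sum_distrib_left by (rule sum.swap)
  also have "\<dots> = (\<Sum>j\<in>exponent_box J d. (\<Prod>k\<in>J. of_nat (i k + j k choose j k)) *
        hasse J d c (\<lambda>k. i k + j k) x * (\<Prod>k\<in>J. w k ^ j k))"
    unfolding hasse_def by (intro sum.cong refl)
      (simp add: sum_distrib_left sum_distrib_right prod.distrib mult_ac)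
  finally show ?thesis .
qed

text \<open>
  Vanishing orders are computed over the finite field but used over polynomial rings above
  it.
\<close>

lemma hasse_hom:
  fixes \<phi> :: "'r::comm_ring_1 \<Rightarrow> 's::comm_ring_1"
  assumes "\<phi> 0 = 0" "\<phi> 1 = 1" "\<And>x y. \<phi> (x + y) = \<phi> x + \<phi> y" "\<And>x y. \<phi> (x * y) = \<phi> x * \<phi> y"
  shows "hasse J d (\<lambda>e. \<phi> (c e)) i (\<lambda>k. \<phi> (x k)) = \<phi> (hasse J d c i x)"
proof -
  have s: "\<phi> (sum f A) = (\<Sum>a\<in>A. \<phi> (f a))" for f and A :: "('a \<Rightarrow> nat) set"
    by (induction A rule: infinite_finite_induct) (auto simp: assms)
  have p: "\<phi> (prod f A) = (\<Prod>a\<in>A. \<phi> (f a))" for f and A :: "'a set"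
    by (induction A rule: infinite_finite_induct) (auto simp: assms)
  have n: "\<phi> (of_nat m) = of_nat m" for m
    by (induction m) (auto simp: assms)
  have w: "\<phi> (y ^ m) = \<phi> y ^ m" for y m
    by (induction m) (auto simp: assms)
  show ?thesis
    unfolding hasse_def by (simp add: s p n w assms)
qed

section \<open>The Schwartz-Zippel lemma with multiplicities\<close>

lemma smult_conv_const_mult: "Polynomial.smult c p = [:c:] * p"
  by simp

text \<open>
  The base case of Schwartz-Zippel: the first \<open>m x\<close> Taylor coefficients at \<open>x\<close> vanish, so
  \<open>(X - x)^(m x)\<close> divides \<open>p\<close>, and the orders of the roots add up to at most the degree.
\<close>

lemma univariate_vanishing_orders_le_degree:
  fixes p :: "'r::idom poly"
  assumes p: "p \<noteq> 0" and S: "finite S" and deg: "degree p \<le> t" "degree p \<le> d"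
  assumes van: "\<And>x i. x \<in> S \<Longrightarrow> i < m x \<Longrightarrow>
     (\<Sum>j\<le>d. coeff p j * (of_nat (j choose i) * x ^ (j - i))) = 0"
  shows "(\<Sum>x\<in>S. m x) \<le> t"
proof -
  have ord: "m x \<le> order x p" if "x \<in> S" for x
  proof -
    let ?l = "[:-x, 1:]"
    have "p = (\<Sum>j\<le>d. Polynomial.smult (coeff p j) (monom 1 1 ^ j))"
      using poly_as_sum_of_monoms'[OF deg(2)] by (simp add: monom_power smult_monom)
    also have "monom 1 1 = ([:x:] + ?l)"
      by (simp add: monom_Suc)
    also have "(\<Sum>j\<le>d. Polynomial.smult (coeff p j) (([:x:] + ?l) ^ j)) =
       (\<Sum>j\<le>d. \<Sum>i\<le>d. [:coeff p j * (of_nat (j choose i) * x ^ (j - i)):] * ?l ^ i)"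
    proof (intro sum.cong refl)
      fix j assume "j \<in> {..d}"
      have "([:x:] + ?l) ^ j = (\<Sum>i\<le>d. of_nat (j choose i) * ([:x:] ^ (j - i)) * ?l ^ i)"
        using hasse_taylor_single[of j d 0 "[:x:]" ?l] \<open>j \<in> {..d}\<close> by simp
      then show "Polynomial.smult (coeff p j) (([:x:] + ?l) ^ j) =
         (\<Sum>i\<le>d. [:coeff p j * (of_nat (j choose i) * x ^ (j - i)):] * ?l ^ i)"
        by (simp only: smult_conv_const_mult sum_distrib_left)
          (intro sum.cong refl, simp add: of_nat_poly poly_const_pow mult_ac)
    qed
    also have "\<dots> = (\<Sum>i\<le>d. \<Sum>j\<le>d. [:coeff p j * (of_nat (j choose i) * x ^ (j - i)):] * ?l ^ i)"
      by (rule sum.swap)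
    also have "\<dots> = (\<Sum>i\<le>d. [:\<Sum>j\<le>d. coeff p j * (of_nat (j choose i) * x ^ (j - i)):] * ?l ^ i)"
    proof (intro sum.cong refl)
      fix i
      have "(\<Sum>j\<le>d. [:f j:]) = [:\<Sum>j\<le>d. f j:]" for f :: "nat \<Rightarrow> 'r"
        by (induction d) auto
      then show "(\<Sum>j\<le>d. [:coeff p j * (of_nat (j choose i) * x ^ (j - i)):] * ?l ^ i) =
         [:\<Sum>j\<le>d. coeff p j * (of_nat (j choose i) * x ^ (j - i)):] * ?l ^ i"
        by (metis (no_types) sum_distrib_right)
    qed
    finally have eq: "p = \<dots>" .
    have "?l ^ m x dvd p"
    proof (subst eq, rule dvd_sum)
      fix i assume "i \<in> {..d}"
      show "?l ^ m x dvd [:\<Sum>j\<le>d. coeff p j * (of_nat (j choose i) * x ^ (j - i)):] * ?l ^ i"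
      proof (cases "i < m x")
        case True
        then show ?thesis using van[OF that True] by simp
      next
        case False
        then show ?thesis by (intro dvd_mult le_imp_power_dvd) auto
      qed
    qed
    then show ?thesis
      using p by (simp add: order_divides)
  qed
  have "(\<Sum>x\<in>S. m x) \<le> (\<Sum>x\<in>S. order x p)"
    by (intro sum_mono ord)
  also have "\<dots> = (\<Sum>x\<in>S \<inter> {x. poly p x = 0}. order x p)"
    using S p by (intro sum.mono_neutral_right) (auto simp: order_root)
  also have "\<dots> \<le> (\<Sum>x | poly p x = 0. order x p)"
    using p by (intro sum_mono2) (auto simp: poly_roots_finite)
  also have "\<dots> \<le> degree p" by (rule sum_order_le_degree[OF p])
  finally show ?thesis using deg by simp
qed

text \<open>
  A nonzero polynomial has finite order at every point: for an exponent \<open>e\<close> of maximal total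
  degree, no other monomial contributes to the \<open>e\<close>-th derivative, which is therefore the constant
  \<open>c e\<close>.
\<close>

lemma ex_hasse_nonzero:
  fixes c :: "('i \<Rightarrow> nat) \<Rightarrow> 'r::idom"
  assumes "finite J" and nz: "\<exists>e\<in>exponent_box J d. c e \<noteq> 0"
  shows "\<exists>i. hasse J d c i x \<noteq> 0"
proof -
  define E where "E = {e \<in> exponent_box J d. c e \<noteq> 0}"
  have E: "finite E" "E \<noteq> {}"
    using assms by (auto simp: E_def)
  define M where "M = Max ((\<lambda>e. sum e J) ` E)"
  have "M \<in> (\<lambda>e. sum e J) ` E"
    unfolding M_def using E by (intro Max_in) auto
  then obtain e where e: "e \<in> E" "sum e J = M" by auto
  have max: "sum e' J \<le> sum e J" if "e' \<in> E" for e'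
    using E that by (auto simp: e(2) M_def)
  have "hasse J d c e x = (\<Sum>e'\<in>{e}. c e' * (\<Prod>k\<in>J. of_nat (e' k choose e k) * x k ^ (e' k - e k)))"
    unfolding hasse_def
  proof (intro sum.mono_neutral_right ballI)
    show "{e} \<subseteq> exponent_box J d" using e by (auto simp: E_def)
    fix e' assume e': "e' \<in> exponent_box J d - {e}"
    show "c e' * (\<Prod>k\<in>J. of_nat (e' k choose e k) * x k ^ (e' k - e k)) = 0"
    proof (rule ccontr)
      assume *: "\<not> ?thesis"
      have le: "e k \<le> e' k" if "k \<in> J" for k
      proof (rule ccontr)
        assume "\<not> e k \<le> e' k"
        then have "(\<Prod>k\<in>J. of_nat (e' k choose e k) * x k ^ (e' k - e k)) = 0"
          using that assms(1) by (intro prod_binomial_eq_0) auto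
        then show False using * by simp
      qed
      have "e' \<in> E" using * e' by (auto simp: E_def)
      then have "sum e' J \<le> sum e J" by (rule max)
      then have "\<forall>k\<in>J. e k = e' k"
        using le sum_strict_mono_ex1[OF assms(1), of e e'] by (meson leD le_neq_implies_less)
      then have "e = e'"
        using e e' by (intro PiE_ext[of e J _ e']) (auto simp: E_def exponent_box_def)
      then show False using e' by simp
    qed
  qed (use assms in auto)
  also have "\<dots> = c e" by simp
  finally show ?thesis using e by (intro exI[of _ e]) (simp add: E_def)
qed

text \<open>
  Fixing the direction \<open>i\<close> and the point \<open>y\<close> in the old variables turns the derivatives in the
  new variable into those of a univariate polynomial, whose coefficients are the \<open>i\<close>-th derivatives
  at \<open>y\<close> of the slices of \<open>c\<close>.
\<close>

lemma hasse_insert: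
  fixes c :: "('i \<Rightarrow> nat) \<Rightarrow> 'r::comm_ring_1"
  assumes J: "finite J" "p \<notin> J"
  shows "hasse (insert p J) d c (i(p := s)) (y(p := x)) =
    (\<Sum>j\<le>d. hasse J d (\<lambda>e. c (e(p := j))) i y * (of_nat (j choose s) * x ^ (j - s)))"
proof -
  let ?g = "\<lambda>(j, e). e(p := j)"
  have inj: "inj_on ?g ({..d} \<times> exponent_box J d)"
    using inj_combinator[OF J(2), of "\<lambda>_. {..d}"] by (simp add: exponent_box_def)
  have img: "exponent_box (insert p J) d = ?g ` ({..d} \<times> exponent_box J d)"
    by (simp add: exponent_box_def PiE_insert_eq)
  have "hasse (insert p J) d c (i(p := s)) (y(p := x)) =
     (\<Sum>(j,e)\<in>{..d} \<times> exponent_box J d. c (e(p := j)) *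
        ((\<Prod>k\<in>J. of_nat (e k choose i k) * y k ^ (e k - i k)) * (of_nat (j choose s) * x ^ (j - s))))"
    unfolding hasse_def img sum.reindex[OF inj] comp_def
  proof (intro sum.cong refl, clarify)
    fix j e
    have "(\<Prod>k\<in>J. of_nat ((e(p := j)) k choose (i(p := s)) k) * (y(p := x)) k ^ ((e(p := j)) k - (i(p := s)) k))
      = (\<Prod>k\<in>J. of_nat (e k choose i k) * y k ^ (e k - i k))"
      using J by (intro prod.cong) auto
    then show "c (e(p := j)) * (\<Prod>k\<in>insert p J. of_nat ((e(p := j)) k choose (i(p := s)) k) *
           (y(p := x)) k ^ ((e(p := j)) k - (i(p := s)) k)) =
       c (e(p := j)) * ((\<Prod>k\<in>J. of_nat (e k choose i k) * y k ^ (e k - i k)) * (of_nat (j choose s) * x ^ (j - s)))"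
      using J by (simp add: mult_ac)
  qed
  also have "\<dots> = (\<Sum>j\<le>d. hasse J d (\<lambda>e. c (e(p := j))) i y * (of_nat (j choose s) * x ^ (j - s)))"
    unfolding hasse_def sum.cartesian_product[symmetric] by (simp add: sum_distrib_left sum_distrib_right mult_ac)
  finally show ?thesis .
qed

text \<open>
  The proof is the one of Dvir, Kopparty, Saraf and Sudan.  Expand the polynomial in powers of
  one variable \<open>p\<close>, with leading coefficient \<open>cj t\<close>.  If \<open>cj t\<close> has order exactly \<open>m' y\<close> at \<open>y\<close>,
  choose a derivative of that order which does not vanish there.  Applied to the whole polynomial, it
  leaves a nonzero univariate polynomial of degree at most \<open>t\<close> on the line above \<open>y\<close>, and
  costs at most \<open>m' y\<close> in the orders on that line.  The orders \<open>m' y\<close> are bounded by induction.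
\<close>

lemma schwartz_zippel_multiplicity:
  fixes c :: "('i \<Rightarrow> nat) \<Rightarrow> 'r::idom"
  assumes "finite J" "finite S" "\<exists>e\<in>exponent_box J d. c e \<noteq> 0" "total_degree_le J d c k"
    and "\<And>x i. x \<in> PiE J (\<lambda>_. S) \<Longrightarrow> sum i J < m x \<Longrightarrow> hasse J d c i x = 0"
  shows "card S * (\<Sum>x\<in>PiE J (\<lambda>_. S). m x) \<le> k * card S ^ card J"
  using assms(1,3-)
proof (induction J arbitrary: c k m rule: finite_induct)
  case empty
  have "m (\<lambda>_. undefined) = 0"
  proof (rule ccontr)
    assume "m (\<lambda>_. undefined) \<noteq> 0"
    then have "hasse {} d c (\<lambda>_. 0) (\<lambda>_. undefined) = 0"
      by (intro empty.prems(3)) auto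
    then show False using empty.prems(1) by (simp add: hasse_def exponent_box_def)
  qed
  then show ?case by simp
next
  case (insert p J)
  define cj where "cj j = (\<lambda>e. c (e(p := j)))" for j
  define Ts where "Ts = {j. j \<le> d \<and> (\<exists>e\<in>exponent_box J d. cj j e \<noteq> 0)}"
  have mem: "e(p := j) \<in> exponent_box (insert p J) d" if "e \<in> exponent_box J d" "j \<le> d" for e j
    using that by (auto simp: exponent_box_def PiE_insert_eq intro!: image_eqI[of _ _ "(j, e)"])
  have Ts: "finite Ts" "Ts \<noteq> {}"
  proof -
    show "finite Ts" by (rule finite_subset[of _ "{..d}"]) (auto simp: Ts_def)
    obtain e where e: "e \<in> exponent_box (insert p J) d" "c e \<noteq> 0"
      using insert.prems(1) by blast
    then obtain j f where "e = f(p := j)" "j \<le> d" "f \<in> exponent_box J d"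
      by (auto simp: exponent_box_def PiE_insert_eq)
    then show "Ts \<noteq> {}" using e by (auto simp: Ts_def cj_def)
  qed
  define t where "t = Max Ts"
  have t: "t \<in> Ts" and tmax: "\<And>j. j \<in> Ts \<Longrightarrow> j \<le> t"
    using Ts by (auto simp: t_def)
  note sum_upd = sum_fun_upd_insert[OF insert.hyps]
  have tdeg: "t + sum e J \<le> k" if "e \<in> exponent_box J d" "cj t e \<noteq> 0" for e
    using insert.prems(2) that mem[of e t] t sum_upd[of e t]
    unfolding total_degree_le_def cj_def Ts_def by auto
  then have tk: "t \<le> k" using t by (force simp: Ts_def)
  define m' where "m' y = (LEAST s. \<exists>i. sum i J = s \<and> hasse J d (cj t) i y \<noteq> 0)" for y
  have m'_ex: "\<exists>i. sum i J = m' y \<and> hasse J d (cj t) i y \<noteq> 0" for y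
  proof -
    have "\<exists>s i. sum i J = s \<and> hasse J d (cj t) i y \<noteq> 0"
      using ex_hasse_nonzero[OF insert.hyps(1), of d "cj t" y] t by (auto simp: Ts_def)
    then show ?thesis unfolding m'_def by (rule LeastI_ex)
  qed
  have m'_least: "hasse J d (cj t) i y = 0" if "sum i J < m' y" for i y
    using not_less_Least[of "sum i J" "\<lambda>s. \<exists>i. sum i J = s \<and> hasse J d (cj t) i y \<noteq> 0"] that
    unfolding m'_def by blast
  have IH: "card S * (\<Sum>y\<in>PiE J (\<lambda>_. S). m' y) \<le> (k - t) * card S ^ card J"
  proof (rule insert.IH)
    show "\<exists>e\<in>exponent_box J d. cj t e \<noteq> 0" using t by (auto simp: Ts_def)
    show "total_degree_le J d (cj t) (k - t)"
      unfolding total_degree_le_def using tdeg by fastforce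
  qed (use m'_least in auto)
  have line: "(\<Sum>x\<in>S. m (y(p := x))) \<le> card S * m' y + t" if y: "y \<in> PiE J (\<lambda>_. S)" for y
  proof -
    obtain i where i: "sum i J = m' y" "hasse J d (cj t) i y \<noteq> 0"
      using m'_ex by blast
    define pol where "pol = (\<Sum>j\<le>d. Polynomial.monom (hasse J d (cj j) i y) j)"
    have cf: "coeff pol j = (if j \<le> d then hasse J d (cj j) i y else 0)" for j
      unfolding pol_def coeff_sum by (auto simp: coeff_monom)
    have zero: "hasse J d (cj j) i y = 0" if "j \<le> d" "j > t" for j
    proof -
      have "j \<notin> Ts" using tmax that by force
      then show ?thesis using that unfolding hasse_def by (auto simp: Ts_def intro!: sum.neutral)
    qed
    \<comment> \<open>truncated subtraction: points of order less than \<open>m' y\<close> count as 0\<close>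
    have "(\<Sum>x\<in>S. m (y(p := x)) - m' y) \<le> t"
    proof (rule univariate_vanishing_orders_le_degree)
      show "pol \<noteq> 0" using cf[of t] i t by (auto simp: Ts_def)
      show "degree pol \<le> t" using zero by (intro degree_le) (auto simp: cf)
      show "degree pol \<le> d" by (intro degree_le) (auto simp: cf)
      fix x s assume x: "x \<in> S" and s: "s < m (y(p := x)) - m' y"
      have "hasse (insert p J) d c (i(p := s)) (y(p := x)) = 0"
      proof (rule insert.prems(3))
        show "y(p := x) \<in> PiE (insert p J) (\<lambda>_. S)"
          using y x by (auto simp: PiE_insert_eq intro!: image_eqI[of _ _ "(x, y)"])
        show "sum (i(p := s)) (insert p J) < m (y(p := x))"
          unfolding sum_upd using s i by linarith
      qed
      then show "(\<Sum>j\<le>d. coeff pol j * (of_nat (j choose s) * x ^ (j - s))) = 0"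
        by (simp add: hasse_insert insert.hyps cf cj_def)
    qed (rule assms(2))
    moreover have "(\<Sum>x\<in>S. m (y(p := x))) \<le> (\<Sum>x\<in>S. (m (y(p := x)) - m' y) + m' y)"
      by (intro sum_mono) auto
    ultimately show ?thesis by (simp add: sum.distrib)
  qed
  have inj: "inj_on (\<lambda>(x, y). y(p := x)) (S \<times> PiE J (\<lambda>_. S))"
    using inj_combinator[OF insert.hyps(2), of "\<lambda>_. S"] by simp
  have "(\<Sum>x\<in>PiE (insert p J) (\<lambda>_. S). m x) = (\<Sum>x\<in>S. \<Sum>y\<in>PiE J (\<lambda>_. S). m (y(p := x)))"
    unfolding PiE_insert_eq sum.reindex[OF inj] sum.cartesian_product by (simp add: comp_def case_prod_unfold)
  also have "\<dots> = (\<Sum>y\<in>PiE J (\<lambda>_. S). \<Sum>x\<in>S. m (y(p := x)))" by (rule sum.swap)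
  also have "\<dots> \<le> (\<Sum>y\<in>PiE J (\<lambda>_. S). card S * m' y + t)"
    by (intro sum_mono line)
  also have "\<dots> = card S * (\<Sum>y\<in>PiE J (\<lambda>_. S). m' y) + t * card S ^ card J"
    using insert.hyps assms(2) by (simp add: sum.distrib sum_distrib_left card_PiE)
  also have "\<dots> \<le> (k - t) * card S ^ card J + t * card S ^ card J"
    by (rule add_right_mono[OF IH])
  also have "\<dots> = k * card S ^ card J"
    using tk by (simp add: add_mult_distrib[symmetric])
  finally have "card S * (\<Sum>x\<in>PiE (insert p J) (\<lambda>_. S). m x) \<le> card S * (k * card S ^ card J)"
    by simp
  then show ?case using insert.hyps by (simp add: mult_ac)
qed

section \<open>Polynomials with prescribed vanishing orders\<close>

definition exponents_le :: "'i set \<Rightarrow> nat \<Rightarrow> ('i \<Rightarrow> nat) set" where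
  "exponents_le J k = {e \<in> PiE J (\<lambda>_. UNIV). sum e J \<le> k}"

lemma exponents_le_subset_box: "finite J \<Longrightarrow> exponents_le J k \<subseteq> exponent_box J k"
  unfolding exponents_le_def exponent_box_def
  by (auto simp: PiE_iff extensional_def intro: order_trans[OF member_le_sum])

lemma finite_exponents_le [simp, intro]: "finite J \<Longrightarrow> finite (exponents_le J k)"
  by (rule finite_subset[OF exponents_le_subset_box]) auto

lemma card_exponents_le:
  "finite J \<Longrightarrow> card (exponents_le J k) = (k + card J) choose card J"
proof (induction J arbitrary: k rule: finite_induct)
  case empty
  show ?case by (simp add: exponents_le_def)
next
  case (insert p J)
  let ?f = "\<lambda>(j, e). e(p := j)"
  note sum_upd = sum_fun_upd_insert[OF insert.hyps]
  have "exponents_le (insert p J) k = ?f ` (SIGMA j:{..k}. exponents_le J (k - j))"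
  proof (intro equalityI subsetI)
    fix e assume "e \<in> exponents_le (insert p J) k"
    then obtain j f where e: "e = f(p := j)" "f \<in> PiE J (\<lambda>_. UNIV)" "sum e (insert p J) \<le> k"
      by (auto simp: exponents_le_def PiE_insert_eq)
    then have "j + sum f J \<le> k" using sum_upd[of f j] by simp
    then show "e \<in> ?f ` (SIGMA j:{..k}. exponents_le J (k - j))"
      using e by (intro image_eqI[of _ _ "(j, f)"]) (auto simp: exponents_le_def)
  next
    fix e assume "e \<in> ?f ` (SIGMA j:{..k}. exponents_le J (k - j))"
    then obtain j f where e: "e = f(p := j)" "j \<le> k" "f \<in> PiE J (\<lambda>_. UNIV)" "sum f J \<le> k - j"
      by (auto simp: exponents_le_def)
    then show "e \<in> exponents_le (insert p J) k"
      using sum_upd[of f j] by (auto simp: exponents_le_def PiE_insert_eq intro!: image_eqI[of _ _ "(j, f)"])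
  qed
  moreover have "inj_on ?f (SIGMA j:{..k}. exponents_le J (k - j))"
    by (rule inj_on_subset[OF inj_combinator[OF insert.hyps(2), of "\<lambda>_. UNIV"]])
       (auto simp: exponents_le_def)
  ultimately have "card (exponents_le (insert p J) k) = (\<Sum>j\<le>k. card (exponents_le J (k - j)))"
    using insert.hyps by (simp add: card_image card_SigmaI)
  also have "\<dots> = (\<Sum>j\<le>k. (k - j + card J) choose card J)"
    by (simp add: insert.IH)
  also have "\<dots> = (\<Sum>j\<le>k. (j + card J) choose card J)"
    using sum.nat_diff_reindex[of "\<lambda>j. (j + card J) choose card J" "Suc k"]
    by (simp add: lessThan_Suc_atMost)
  also have "\<dots> = Suc (card J + k) choose Suc (card J)"
    by (induction k) (auto simp: add_ac)
  finally show ?case using insert.hyps by (simp add: add_ac)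
qed

text \<open>
  This compares \<open>q^N\<close> copies of the vanishing conditions of order \<open>m\<close> with the
  coefficients of a polynomial of degree \<open>d\<close>.  Both binomial coefficients are products of \<open>N\<close>
  factors, and the comparison holds factor by factor.
\<close>

lemma binomial_scaling:
  fixes \<theta> :: real and q m d N :: nat
  assumes "q * (m + N) \<le> \<theta> * d" "1 \<le> m" "0 \<le> \<theta>"
  shows "real ((m - 1 + N) choose N) * q ^ N \<le> \<theta> ^ N * real ((d + N) choose N)"
proof -
  have "real ((m - 1 + M) choose M) * q ^ M \<le> \<theta> ^ M * real ((d + M) choose M)" if "M \<le> N" for M
    using that
  proof (induction M)
    case 0
    then show ?case by simp
  next
    case (Suc M)
    have step: "real (Suc M) * real ((x + Suc M) choose Suc M) = real (x + Suc M) * real ((x + M) choose M)" for x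
      unfolding of_nat_mult[symmetric] add_Suc_right using Suc_times_binomial[of M "x + M"] by (rule arg_cong)
    have "real q * real (m - 1 + Suc M) \<le> real (q * (m + N))"
      unfolding of_nat_mult using assms Suc.prems by (intro mult_left_mono) auto
    also have "\<dots> \<le> \<theta> * real (d + Suc M)"
      using assms by (intro order_trans[OF assms(1)] mult_left_mono) auto
    finally have f: "real q * real (m - 1 + Suc M) \<le> \<theta> * real (d + Suc M)" .
    have "real (Suc M) * (real ((m - 1 + Suc M) choose Suc M) * q ^ Suc M) =
        (real q * real (m - 1 + Suc M)) * (real ((m - 1 + M) choose M) * q ^ M)"
      by (subst mult.assoc[symmetric], subst step) (simp add: mult_ac)
    also have "\<dots> \<le> (\<theta> * real (d + Suc M)) * (\<theta> ^ M * real ((d + M) choose M))"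
      by (rule mult_mono[OF f Suc.IH]) (use Suc.prems assms in auto)
    also have "\<dots> = real (Suc M) * (\<theta> ^ Suc M * real ((d + Suc M) choose Suc M))"
      by (subst mult.left_commute, subst step) (simp add: mult_ac)
    finally show ?case
      by (rule mult_left_le_imp_le) simp
  qed
  then show ?thesis by blast
qed

text \<open>
  Over a finite field the existence of a solution of an underdetermined linear system is a
  pigeonhole argument: two polynomials satisfy the conditions with equal values, and their
  difference is the required one.
\<close>

lemma ex_polynomial_vanishing:
  fixes pt :: "'v \<Rightarrow> 'i \<Rightarrow> 'a::{field,finite}"
  assumes fin: "finite V" "finite J"
    and less: "(\<Sum>v\<in>V. card {i \<in> PiE J (\<lambda>_. UNIV). sum i J < m v}) < card (exponents_le J d)"
  shows "\<exists>c. (\<exists>e\<in>exponent_box J d. c e \<noteq> 0) \<and> total_degree_le J d c d \<and>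
      (\<forall>v\<in>V. \<forall>i. sum i J < m v \<longrightarrow> hasse J d c i (pt v) = 0)"
proof -
  define I where "I v = {i \<in> PiE J (\<lambda>_. UNIV). sum i J < m v}" for v
  define C where "C = Sigma V I"
  have "finite (I v)" for v
    by (rule finite_subset[OF _ finite_exponents_le[OF fin(2), of "m v"]]) (auto simp: I_def exponents_le_def)
  then have C: "finite C" "card C < card (exponents_le J d)"
    using less fin by (auto simp: C_def I_def)
  define ext where "ext x = (\<lambda>e. if e \<in> exponents_le J d then x e else (0::'a))" for x
  define X where "X = PiE (exponents_le J d) (\<lambda>_. UNIV :: 'a set)"
  define \<Phi> where "\<Phi> x = (\<lambda>vi\<in>C. hasse J d (ext x) (snd vi) (pt (fst vi)))" for x
  \<comment> \<open>strict monotonicity of \<open>n \<mapsto> q^n\<close> turns fewer conditions than coefficients into a proper inequality of cardinalities\<close>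
  have "CARD('a) > 1"
    using card_mono[of UNIV "{0, 1 :: 'a}"] by simp
  then have "card (PiE C (\<lambda>_. UNIV :: 'a set)) < card X"
    using C fin by (simp add: X_def card_PiE)
  moreover have "\<Phi> ` X \<subseteq> PiE C (\<lambda>_. UNIV)" by (auto simp: \<Phi>_def)
  ultimately have "card (\<Phi> ` X) < card X"
    using C(1) by (meson card_mono finite_PiE finite le_less_trans)
  then obtain x y where xy: "x \<in> X" "y \<in> X" "x \<noteq> y" "\<Phi> x = \<Phi> y"
    using pigeonhole[of \<Phi> X] by (auto simp: inj_on_def)
  define c where "c e = ext x e - ext y e" for e
  have hd: "hasse J d c i p = hasse J d (ext x) i p - hasse J d (ext y) i p" for i p
    by (simp add: hasse_def c_def left_diff_distrib sum_subtractf)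
  show ?thesis
  proof (intro exI[of _ c] conjI ballI allI impI)
    obtain e where "x e \<noteq> y e" using xy(3) by auto
    moreover have e: "e \<in> exponents_le J d"
      using xy(1,2) \<open>x e \<noteq> y e\<close> unfolding X_def by (metis PiE_arb)
    ultimately have "c e \<noteq> 0" by (simp add: c_def ext_def)
    then show "\<exists>e\<in>exponent_box J d. c e \<noteq> 0"
      using e exponents_le_subset_box[OF fin(2)] by blast
    show "total_degree_le J d c d"
      by (auto simp: total_degree_le_def c_def ext_def exponents_le_def split: if_splits)
    fix v i assume v: "v \<in> V" and i: "sum i J < m v"
    have "(v, restrict i J) \<in> C"
      using v i by (auto simp: C_def I_def)
    then have "hasse J d c (restrict i J) (pt v) = 0"
      using fun_cong[OF xy(4), of "(v, restrict i J)"] by (simp add: \<Phi>_def hd)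
    then show "hasse J d c i (pt v) = 0"
      by (subst hasse_cong[of J d c c i "restrict i J" "pt v" "pt v"]) auto
  qed
qed

section \<open>Restricting a polynomial to an affine subspace\<close>

text \<open>
  Polynomials are evaluated along curves in the ring \<open>'a poly poly\<close>.  The outer variable is the
  parameter of the curve, and the inner variable provides generic directions.
\<close>

definition cst :: "'a::comm_ring_1 \<Rightarrow> 'a poly poly" where
  "cst x = [:[:x:]:]"

lemma cst_simps [simp]:
  "cst 0 = 0" "cst 1 = 1" "cst (x + y) = cst x + cst y" "cst (x * y) = cst x * cst y"
  by (simp_all add: cst_def one_pCons)

lemma cst_of_nat [simp]: "cst (of_nat n) = of_nat n"
  by (induction n) auto

lemma cst_sum: "cst (sum f A) = (\<Sum>a\<in>A. cst (f a))"
  by (induction A rule: infinite_finite_induct) auto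

text \<open>
  Substituting affine forms into a polynomial gives again a polynomial.  Instead of computing its
  coefficients, it is treated as a function on the ring \<open>'a poly poly\<close> that lies in the span of the
  monomials of degree at most \<open>k\<close>; this class is closed under sums and products.
\<close>

definition polyfun :: "'i set \<Rightarrow> nat \<Rightarrow> (('i \<Rightarrow> 'a poly poly) \<Rightarrow> 'a::comm_ring_1 poly poly) \<Rightarrow> bool" where
  "polyfun A k G \<longleftrightarrow> (\<exists>g. \<forall>w. G w = (\<Sum>e\<in>exponents_le A k. cst (g e) * (\<Prod>j\<in>A. w j ^ e j)))"

lemma polyfun_zero: "polyfun A k (\<lambda>_. 0)"
  unfolding polyfun_def by (intro exI[of _ "\<lambda>_. 0"]) simp

lemma polyfun_add: "polyfun A k F \<Longrightarrow> polyfun A k G \<Longrightarrow> polyfun A k (\<lambda>w. F w + G w)"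
  unfolding polyfun_def
proof (elim exE)
  fix f g
  assume "\<forall>w. F w = (\<Sum>e\<in>exponents_le A k. cst (f e) * (\<Prod>j\<in>A. w j ^ e j))"
    and "\<forall>w. G w = (\<Sum>e\<in>exponents_le A k. cst (g e) * (\<Prod>j\<in>A. w j ^ e j))"
  then show "\<exists>g. \<forall>w. F w + G w = (\<Sum>e\<in>exponents_le A k. cst (g e) * (\<Prod>j\<in>A. w j ^ e j))"
    by (intro exI[of _ "\<lambda>e. f e + g e"]) (simp add: distrib_right sum.distrib)
qed

lemma polyfun_sum: "(\<And>x. x \<in> X \<Longrightarrow> polyfun A k (F x)) \<Longrightarrow> polyfun A k (\<lambda>w. \<Sum>x\<in>X. F x w)"
  by (induction X rule: infinite_finite_induct) (auto intro: polyfun_zero polyfun_add)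

lemma polyfun_monomial:
  assumes "finite A" "sum e A \<le> k"
  shows "polyfun A k (\<lambda>w. cst x * (\<Prod>j\<in>A. w j ^ e j))"
  unfolding polyfun_def
proof (intro exI[of _ "\<lambda>f. if f = restrict e A then x else 0"] allI)
  fix w :: "'a \<Rightarrow> 'b poly poly"
  have "restrict e A \<in> exponents_le A k"
    using assms by (auto simp: exponents_le_def)
  then show "cst x * (\<Prod>j\<in>A. w j ^ e j) =
     (\<Sum>f\<in>exponents_le A k. cst (if f = restrict e A then x else 0) * (\<Prod>j\<in>A. w j ^ f j))"
    using assms by (subst sum.remove[of _ "restrict e A"]) auto
qed

lemma polyfun_mult:
  assumes A: "finite A" and F: "polyfun A k F" and G: "polyfun A l G"
  shows "polyfun A (k + l) (\<lambda>w. F w * G w)"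
proof -
  from F obtain f where f: "\<And>w. F w = (\<Sum>e\<in>exponents_le A k. cst (f e) * (\<Prod>j\<in>A. w j ^ e j))"
    unfolding polyfun_def by blast
  from G obtain g where g: "\<And>w. G w = (\<Sum>e\<in>exponents_le A l. cst (g e) * (\<Prod>j\<in>A. w j ^ e j))"
    unfolding polyfun_def by blast
  have eq: "(\<lambda>w. F w * G w) = (\<lambda>w. \<Sum>e\<in>exponents_le A k. \<Sum>e'\<in>exponents_le A l.
      cst (f e * g e') * (\<Prod>j\<in>A. w j ^ (e j + e' j)))"
    by (simp add: f g sum_product power_add prod.distrib mult_ac)
  show ?thesis
    unfolding eq using A
    by (intro polyfun_sum polyfun_monomial) (auto simp: exponents_le_def sum.distrib)
qed

lemma polyfun_mono: "finite A \<Longrightarrow> polyfun A k F \<Longrightarrow> k \<le> l \<Longrightarrow> polyfun A l F"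
proof -
  assume A: "finite A" and F: "polyfun A k F" and kl: "k \<le> l"
  from F obtain f where f: "\<And>w. F w = (\<Sum>e\<in>exponents_le A k. cst (f e) * (\<Prod>j\<in>A. w j ^ e j))"
    unfolding polyfun_def by blast
  have eq: "F = (\<lambda>w. \<Sum>e\<in>exponents_le A k. cst (f e) * (\<Prod>j\<in>A. w j ^ e j))"
    by (rule ext) (rule f)
  show ?thesis
    unfolding eq using A kl by (intro polyfun_sum polyfun_monomial) (auto simp: exponents_le_def)
qed

lemma polyfun_const: "finite A \<Longrightarrow> polyfun A k (\<lambda>_. cst x)"
  using polyfun_monomial[of A "\<lambda>_. 0" k x] by simp

lemma polyfun_var: "finite A \<Longrightarrow> p \<in> A \<Longrightarrow> polyfun A 1 (\<lambda>w. cst x * w p)"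
proof -
  assume A: "finite A" "p \<in> A"
  have "(\<Prod>j\<in>A. w j ^ (if j = p then 1 else 0)) = w p" for w :: "'a \<Rightarrow> 'b poly poly"
    using A by (subst prod.remove[of _ p]) auto
  then show ?thesis
    using polyfun_monomial[of A "\<lambda>j. if j = p then 1 else 0" 1 x] A by simp
qed

lemma polyfun_affine: "finite A \<Longrightarrow> polyfun A 1 (\<lambda>w. cst z + (\<Sum>j\<in>A. cst (u j) * w j))"
  by (intro polyfun_add polyfun_const polyfun_sum polyfun_var) auto

lemma polyfun_power: "finite A \<Longrightarrow> polyfun A 1 F \<Longrightarrow> polyfun A n (\<lambda>w. F w ^ n)"
proof (induction n)
  case 0
  then show ?case using polyfun_const[of A 0 1] by simp
next
  case (Suc n)
  then show ?case using polyfun_mult[of A 1 F n "\<lambda>w. F w ^ n"] by simp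
qed

lemma polyfun_prod:
  "finite A \<Longrightarrow> (\<And>x. x \<in> X \<Longrightarrow> polyfun A (n x) (F x)) \<Longrightarrow> polyfun A (sum n X) (\<lambda>w. \<Prod>x\<in>X. F x w)"
proof (induction X rule: infinite_finite_induct)
  case (insert x X)
  then show ?case using polyfun_mult[of A "n x" "F x" "sum n X" "\<lambda>w. \<Prod>x\<in>X. F x w"] by simp
qed (use polyfun_const[of A 0 1] in auto)

lemma sum_diff_exponents:
  assumes "finite J" "\<And>k. k \<in> J \<Longrightarrow> i k \<le> (e k :: nat)"
  shows "(\<Sum>k\<in>J. e k - i k) = sum e J - sum i J"
  using assms by (simp add: sum_subtractf_nat)

lemma polyfun_hasse_affine:
  assumes fin: "finite A" "finite I" and deg: "total_degree_le I d c k"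
  shows "polyfun A (k - sum i I)
     (\<lambda>w. hasse I d (\<lambda>e. cst (c e)) i (\<lambda>\<kappa>. cst (z \<kappa>) + (\<Sum>j\<in>A. cst (u \<kappa> j) * w j)))"
  unfolding hasse_def
proof (rule polyfun_sum)
  fix e assume e: "e \<in> exponent_box I d"
  let ?l = "\<lambda>\<kappa> w. cst (z \<kappa>) + (\<Sum>j\<in>A. cst (u \<kappa> j) * w j)"
  show "polyfun A (k - sum i I) (\<lambda>w. cst (c e) *
      (\<Prod>\<kappa>\<in>I. of_nat (e \<kappa> choose i \<kappa>) * ?l \<kappa> w ^ (e \<kappa> - i \<kappa>)))"
  proof (cases "c e = 0 \<or> (\<exists>\<kappa>\<in>I. e \<kappa> < i \<kappa>)")
    case True
    have "(\<Prod>\<kappa>\<in>I. of_nat (e \<kappa> choose i \<kappa>) * ?l \<kappa> w ^ (e \<kappa> - i \<kappa>)) = 0" if "\<kappa> \<in> I" "e \<kappa> < i \<kappa>" for w \<kappa>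
      using that fin by (intro prod_binomial_eq_0)
    then have "(\<lambda>w. cst (c e) * (\<Prod>\<kappa>\<in>I. of_nat (e \<kappa> choose i \<kappa>) * ?l \<kappa> w ^ (e \<kappa> - i \<kappa>))) = (\<lambda>_. 0)"
      using True by fastforce
    then show ?thesis using polyfun_zero by metis
  next
    case False
    have "polyfun A (0 + (\<Sum>\<kappa>\<in>I. 0 + (e \<kappa> - i \<kappa>))) (\<lambda>w. cst (c e) *
      (\<Prod>\<kappa>\<in>I. cst (of_nat (e \<kappa> choose i \<kappa>)) * ?l \<kappa> w ^ (e \<kappa> - i \<kappa>)))"
      by (intro polyfun_mult polyfun_prod polyfun_const polyfun_power polyfun_affine fin)
    moreover have "0 + (\<Sum>\<kappa>\<in>I. 0 + (e \<kappa> - i \<kappa>)) \<le> k - sum i I"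
      using sum_diff_exponents[of I i e] False fin deg e
      by (force simp: total_degree_le_def intro: diff_le_mono)
    ultimately show ?thesis
      using polyfun_mono[OF fin(1)] by simp
  qed
qed

lemma base_digits_less:
  "(\<And>k. k < a \<Longrightarrow> e k < (W::nat)) \<Longrightarrow> (\<Sum>k<a. e k * W ^ k) < W ^ a"
proof (induction a)
  case (Suc a)
  have "(\<Sum>k<Suc a. e k * W ^ k) < W ^ a + e a * W ^ a"
    using Suc by simp
  also have "\<dots> = Suc (e a) * W ^ a" by simp
  also have "\<dots> \<le> W * W ^ a"
    using Suc.prems[of a] by (intro mult_right_mono) auto
  finally show ?case by simp
qed auto

lemma base_digits_inject:
  "(\<And>k. k < a \<Longrightarrow> e k < (W::nat)) \<Longrightarrow> (\<And>k. k < a \<Longrightarrow> f k < W) \<Longrightarrow>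
   (\<Sum>k<a. e k * W ^ k) = (\<Sum>k<a. f k * W ^ k) \<Longrightarrow> k < a \<Longrightarrow> e k = f k"
proof (induction a)
  case (Suc a)
  let ?e = "\<Sum>k<a. e k * W ^ k" and ?f = "\<Sum>k<a. f k * W ^ k"
  have l: "?e < W ^ a" "?f < W ^ a"
    by (intro base_digits_less; use Suc.prems in auto)+
  have eq: "?e + W ^ a * e a = ?f + W ^ a * f a"
    using Suc.prems(3) by (simp add: mult.commute)
  have pos: "W ^ a \<noteq> 0" using l by linarith
  have "e a = (?e + W ^ a * e a) div W ^ a"
    by (simp only: div_mult_self2[OF pos] div_less[OF l(1)] add_0)
  also have "\<dots> = f a"
    unfolding eq by (simp only: div_mult_self2[OF pos] div_less[OF l(2)] add_0)
  finally have a: "e a = f a" .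
  then show ?case using Suc eq by (cases "k = a") auto
qed auto

text \<open>
  Kronecker substitution: replacing the \<open>k\<close>-th variable by \<open>X^(W^k)\<close> with \<open>W\<close> larger than
  all exponents sends different monomials to different powers of \<open>X\<close>, so that no cancellation
  occurs.  It provides a single point at which vanishing means being the zero polynomial.
\<close>

lemma kronecker_zero:
  fixes g :: "(nat \<Rightarrow> nat) \<Rightarrow> 'r::comm_ring_1"
  assumes E: "finite E" "E \<subseteq> exponent_box {..<a} d" and W: "d < W"
    and zero: "(\<Sum>e\<in>E. [:g e:] * (\<Prod>k<a. Polynomial.monom 1 (W ^ k) ^ e k)) = 0" and e: "e \<in> E"
  shows "g e = 0"
proof -
  let ?\<kappa> = "\<lambda>e. \<Sum>k<a. e k * W ^ k"
  have mon: "[:g f:] * (\<Prod>k<a. Polynomial.monom 1 (W ^ k) ^ f k) = Polynomial.monom (g f) (?\<kappa> f)" for f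
  proof -
    have "(\<Prod>k<n. Polynomial.monom (1::'r) (W ^ k) ^ f k) = Polynomial.monom 1 (\<Sum>k<n. f k * W ^ k)" for n
      by (induction n) (auto simp: monom_power mult_monom ac_simps)
    then show ?thesis by (simp add: smult_monom)
  qed
  have inj: "?\<kappa> f = ?\<kappa> e \<longleftrightarrow> f = e" if "f \<in> E" for f
  proof
    assume "?\<kappa> f = ?\<kappa> e"
    then have "f k = e k" if "k < a" for k
      using base_digits_inject[of a f W e k] that \<open>f \<in> E\<close> e E(2) W
      by (force simp: exponent_box_def PiE_iff)
    then show "f = e"
      using that e E(2) by (intro PiE_ext[of f "{..<a}" "\<lambda>_. {..d}" e]) (auto simp: exponent_box_def)
  qed simp
  have "0 = coeff (\<Sum>f\<in>E. Polynomial.monom (g f) (?\<kappa> f)) (?\<kappa> e)"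
    using zero by (simp only: mon coeff_0)
  also have "\<dots> = (\<Sum>f\<in>E. if f = e then g f else 0)"
    unfolding coeff_sum by (intro sum.cong refl) (use inj in \<open>auto simp: coeff_monom\<close>)
  also have "\<dots> = g e" using E(1) e by simp
  finally show ?thesis by simp
qed

lemma cst_hasse: "hasse J d (\<lambda>e. cst (c e)) i (\<lambda>k. cst (x k)) = cst (hasse J d c i x)"
  by (rule hasse_hom) auto

lemma hasse_eq_0_outside_box:
  assumes "finite J" "k \<in> J" "d < i k"
  shows "hasse J d c i x = 0"
  unfolding hasse_def
proof (intro sum.neutral ballI)
  fix e assume "e \<in> exponent_box J d"
  then have "e k < i k"
    using assms by (auto simp: exponent_box_def PiE_iff)
  then have "(\<Prod>k\<in>J. of_nat (e k choose i k) * x k ^ (e k - i k)) = 0"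
    by (rule prod_binomial_eq_0[OF assms(1,2)])
  then show "c e * (\<Prod>k\<in>J. of_nat (e k choose i k) * x k ^ (e k - i k)) = 0" by simp
qed

text \<open>
  The order of a polynomial at \<open>h\<close> can be read off along one generic line through \<open>h\<close>: the
  coefficient of the \<open>n\<close>-th power of the line parameter is the Kronecker substitution of the
  derivatives of order \<open>n\<close>.  This converts divisibility along curves, which is stable under
  substitutions, back into vanishing of Hasse derivatives.
\<close>

lemma generic_line_order:
  fixes g :: "(nat \<Rightarrow> nat) \<Rightarrow> 'a::idom" and h :: "nat \<Rightarrow> 'a"
  assumes W: "D < W"
    and dvd: "Polynomial.monom 1 M dvd hasse {..<a} D (\<lambda>e. cst (g e)) (\<lambda>_. 0)
        (\<lambda>k. cst (h k) + [:0, Polynomial.monom 1 (W ^ k):])"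
    and j: "sum j {..<a} < M"
  shows "hasse {..<a} D g j h = 0"
proof (cases "\<exists>k<a. D < j k")
  case True
  then show ?thesis by (auto intro: hasse_eq_0_outside_box)
next
  case False
  define j' where "j' = restrict j {..<a}"
  have "j k \<le> D" if "k < a" for k
    using False that by (meson not_less)
  then have j'box: "j' \<in> exponent_box {..<a} D"
    by (auto simp: j'_def exponent_box_def)
  define n where "n = sum j' {..<a}"
  have n: "n < M" using j by (simp add: n_def j'_def)
  let ?E = "{f \<in> exponent_box {..<a} D. sum f {..<a} = n}"
  let ?Y = "\<lambda>f. \<Prod>k<a. Polynomial.monom (1::'a) (W ^ k) ^ f k"
  have pw: "(\<Prod>k<a. [:0, Polynomial.monom (1::'a) (W ^ k):] ^ f k) = Polynomial.monom (?Y f) (sum f {..<a})" for f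
  proof -
    have X: "[:0, y:] = Polynomial.monom y 1" for y :: "'a poly"
      by (simp add: monom_Suc monom_0)
    show ?thesis
      unfolding X by (induction a) (auto simp: monom_power mult_monom monom_0 ac_simps)
  qed
  have expand: "hasse {..<a} D (\<lambda>e. cst (g e)) (\<lambda>_. 0) (\<lambda>k. cst (h k) + [:0, Polynomial.monom 1 (W ^ k):])
     = (\<Sum>f\<in>exponent_box {..<a} D. cst (hasse {..<a} D g f h) * Polynomial.monom (?Y f) (sum f {..<a}))"
    unfolding hasse_taylor[OF finite_lessThan] pw by (simp add: cst_hasse)
  have "(\<Sum>f\<in>?E. [:hasse {..<a} D g f h:] * ?Y f) =
     coeff (\<Sum>f\<in>exponent_box {..<a} D. cst (hasse {..<a} D g f h) * Polynomial.monom (?Y f) (sum f {..<a})) n"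
    unfolding coeff_sum by (intro sum.mono_neutral_cong_left) (auto simp: cst_def smult_monom coeff_monom)
  also have "\<dots> = 0"
    using dvd n unfolding monom_1_dvd_iff' expand by blast
  finally have "hasse {..<a} D g j' h = 0"
    by (rule kronecker_zero[where E = ?E and g = "\<lambda>f. hasse {..<a} D g f h", OF _ _ W, rotated 2]) (use j'box in \<open>auto simp: n_def\<close>)
  then show ?thesis
    by (subst hasse_cong[of _ _ g g j j' h h]) (auto simp: j'_def)
qed

text \<open>
  Conversely, vanishing of the derivatives of order less than \<open>m\<close> at \<open>v\<close> gives divisibility along
  every line through \<open>v\<close>; taking an \<open>i\<close>-th derivative first costs \<open>sum i I\<close> in the order.
\<close>

lemma hasse_affine_order:
  fixes c :: "('j \<Rightarrow> nat) \<Rightarrow> 'a::idom"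
  assumes I: "finite I" and van: "\<And>i'. sum i' I < m \<Longrightarrow> hasse I d c i' v = 0"
  shows "Polynomial.monom 1 (m - sum i I) dvd
    hasse I d (\<lambda>e. cst (c e)) i (\<lambda>\<kappa>. cst (v \<kappa>) + Polynomial.monom 1 1 * r \<kappa>)"
proof (subst hasse_taylor[OF I], rule dvd_sum)
  fix j assume "j \<in> exponent_box I d"
  show "Polynomial.monom 1 (m - sum i I) dvd
     (\<Prod>k\<in>I. of_nat (i k + j k choose j k)) * hasse I d (\<lambda>e. cst (c e)) (\<lambda>k. i k + j k) (\<lambda>\<kappa>. cst (v \<kappa>)) *
     (\<Prod>k\<in>I. (Polynomial.monom 1 1 * r k) ^ j k)"
  proof (cases "sum i I + sum j I < m")
    case True
    then have "hasse I d c (\<lambda>k. i k + j k) v = 0"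
      by (intro van) (simp add: sum.distrib)
    then show ?thesis by (simp add: cst_hasse)
  next
    case False
    have "(\<Prod>k\<in>I. (Polynomial.monom 1 1 * r k) ^ j k) = (\<Prod>k\<in>I. Polynomial.monom 1 1 ^ j k) * (\<Prod>k\<in>I. r k ^ j k)"
      by (simp add: power_mult_distrib prod.distrib)
    also have "(\<Prod>k\<in>I. Polynomial.monom (1::'a poly) 1 ^ j k) = Polynomial.monom 1 1 ^ sum j I"
      by (rule power_sum[symmetric])
    also have "\<dots> = Polynomial.monom 1 (sum j I)"
      by (simp add: monom_power)
    finally have eq: "(\<Prod>k\<in>I. (Polynomial.monom 1 1 * r k) ^ j k) = \<dots> * (\<Prod>k\<in>I. r k ^ j k)" .
    have "Polynomial.monom (1::'a poly) (m - sum i I) dvd Polynomial.monom 1 (sum j I)"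
      unfolding monom_1_dvd_iff' using False by (auto simp: coeff_monom)
    then show ?thesis unfolding eq by (intro dvd_mult dvd_mult2)
  qed
qed

text \<open>
  The restriction of the \<open>i\<close>-th derivative to the affine subspace is a polynomial in \<open>a\<close>
  variables of degree at most \<open>k - sum i I\<close>, with order at least \<open>m h - sum i I\<close> at the point with
  parameter \<open>h\<close>.  If these orders are too large for Schwartz-Zippel over the whole of \<open>F_q^a\<close>, the
  restriction is the zero polynomial, and so it vanishes also at parameters \<open>w\<close> in the larger ring.
\<close>

lemma affine_restriction_vanishes:
  fixes c :: "('j \<Rightarrow> nat) \<Rightarrow> 'a::{field,finite}" and m :: "(nat \<Rightarrow> 'a) \<Rightarrow> nat"
  assumes I: "finite I" and deg: "total_degree_le I d c k"
    and van: "\<And>h i'. h \<in> PiE {..<a} (\<lambda>_. UNIV) \<Longrightarrow> sum i' I < m h \<Longrightarrow>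
        hasse I d c i' (\<lambda>\<kappa>. z \<kappa> + (\<Sum>j<a. u \<kappa> j * h j)) = 0"
    and big: "(k - sum i I) * CARD('a) ^ a < CARD('a) * (\<Sum>h\<in>PiE {..<a} (\<lambda>_. UNIV). m h - sum i I)"
  shows "hasse I d (\<lambda>e. cst (c e)) i (\<lambda>\<kappa>. cst (z \<kappa>) + (\<Sum>j<a. cst (u \<kappa> j) * w j)) = 0"
proof -
  define D where "D = k - sum i I"
  define G where "G w = hasse I d (\<lambda>e. cst (c e)) i (\<lambda>\<kappa>. cst (z \<kappa>) + (\<Sum>j<a. cst (u \<kappa> j) * w j))" for w
  have "polyfun {..<a} D G"
    using polyfun_hasse_affine[of "{..<a}" I d c k i z u] I deg by (simp add: G_def[abs_def] D_def)
  then obtain g where g: "G w = (\<Sum>e\<in>exponents_le {..<a} D. cst (g e) * (\<Prod>j<a. w j ^ e j))" for w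
    unfolding polyfun_def by blast
  define g' where "g' e = (if e \<in> exponents_le {..<a} D then g e else 0)" for e
  have G: "G w = hasse {..<a} D (\<lambda>e. cst (g' e)) (\<lambda>_. 0) w" for w
    unfolding hasse_def g using exponents_le_subset_box[of "{..<a}" D]
    by (intro sum.mono_neutral_cong_left) (auto simp: g'_def)
  have "\<not> (\<exists>e\<in>exponent_box {..<a} D. g' e \<noteq> 0)"
  proof
    assume nz: "\<exists>e\<in>exponent_box {..<a} D. g' e \<noteq> 0"
    have "CARD('a) * (\<Sum>h\<in>PiE {..<a} (\<lambda>_. UNIV). m h - sum i I) \<le> D * CARD('a) ^ card {..<a}"
    proof (rule schwartz_zippel_multiplicity[OF _ _ nz])
      show "total_degree_le {..<a} D g' D"
        by (auto simp: total_degree_le_def g'_def exponents_le_def split: if_splits)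
      fix h j assume h: "h \<in> PiE {..<a} (\<lambda>_. UNIV :: 'a set)" and j: "sum j {..<a} < m h - sum i I"
      show "hasse {..<a} D g' j h = 0"
      proof (rule generic_line_order[OF lessI _ j])
        let ?r = "\<lambda>\<kappa>. \<Sum>j<a. cst (u \<kappa> j) * [:Polynomial.monom 1 (Suc D ^ j):]"
        have "cst (z \<kappa>) + (\<Sum>j<a. cst (u \<kappa> j) * (cst (h j) + [:0, Polynomial.monom 1 (Suc D ^ j):])) =
            cst (z \<kappa> + (\<Sum>j<a. u \<kappa> j * h j)) + Polynomial.monom 1 1 * ?r \<kappa>" for \<kappa>
        proof -
          have "cst (u \<kappa> j) * (cst (h j) + [:0, Polynomial.monom 1 (Suc D ^ j):]) =
             cst (u \<kappa> j * h j) + Polynomial.monom 1 1 * (cst (u \<kappa> j) * [:Polynomial.monom 1 (Suc D ^ j):])" for j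
            by (simp add: monom_Suc monom_0 cst_def)
          then show ?thesis
            by (simp only: cst_sum cst_simps sum.distrib sum_distrib_left add.assoc)
        qed
        then show "Polynomial.monom 1 (m h - sum i I) dvd hasse {..<a} D (\<lambda>e. cst (g' e)) (\<lambda>_. 0)
            (\<lambda>k. cst (h k) + [:0, Polynomial.monom 1 (Suc D ^ k):])"
          using hasse_affine_order[where r = ?r and i = i, OF I van[OF h]]
          by (simp only: G[symmetric] G_def)
      qed
    qed auto
    then show False using big by (simp add: D_def)
  qed
  then have "G w = 0" unfolding G hasse_def by (intro sum.neutral) auto
  then show ?thesis by (simp add: G_def)
qed

lemma coeff_prod_linear:
  fixes z r :: "'j \<Rightarrow> 'r::comm_ring_1"
  assumes "finite I" "sum n I \<le> N"
  shows "coeff (\<Prod>\<kappa>\<in>I. [:z \<kappa>, r \<kappa>:] ^ n \<kappa>) N = (if sum n I = N then (\<Prod>\<kappa>\<in>I. r \<kappa> ^ n \<kappa>) else 0)"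
proof -
  have mult: "degree (p * q) \<le> k + l \<and> coeff (p * q) (k + l) = coeff p k * coeff q l"
    if "degree p \<le> k" "degree q \<le> l" for p q :: "'r poly" and k l
  proof
    show "degree (p * q) \<le> k + l" using degree_mult_le[of p q] that by linarith
    have "coeff (p * q) (k + l) = (\<Sum>i\<le>k + l. coeff p i * coeff q (k + l - i))"
      by (rule coeff_mult)
    also have "\<dots> = (\<Sum>i\<in>{k}. coeff p i * coeff q (k + l - i))"
    proof (intro sum.mono_neutral_right ballI)
      fix i assume "i \<in> {..k + l} - {k}"
      then have "k < i \<or> l < k + l - i" by auto
      then show "coeff p i * coeff q (k + l - i) = 0"
        using that by (auto simp: coeff_eq_0)
    qed auto
    finally show "coeff (p * q) (k + l) = coeff p k * coeff q l" by simp
  qed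
  have pow: "degree ([:x, y:] ^ k) \<le> k \<and> coeff ([:x, y:] ^ k) k = y ^ k" for x y :: 'r and k
  proof (induction k)
    case (Suc k)
    then show ?case using mult[of "[:x, y:]" 1 "[:x, y:] ^ k" k] by simp
  qed simp
  have "degree (\<Prod>\<kappa>\<in>I. [:z \<kappa>, r \<kappa>:] ^ n \<kappa>) \<le> sum n I \<and>
     coeff (\<Prod>\<kappa>\<in>I. [:z \<kappa>, r \<kappa>:] ^ n \<kappa>) (sum n I) = (\<Prod>\<kappa>\<in>I. r \<kappa> ^ n \<kappa>)"
    using assms(1)
  proof (induction I rule: finite_induct)
    case (insert \<kappa> I)
    then show ?case
      using mult[of "[:z \<kappa>, r \<kappa>:] ^ n \<kappa>" "n \<kappa>" "\<Prod>\<kappa>\<in>I. [:z \<kappa>, r \<kappa>:] ^ n \<kappa>" "sum n I"] pow[of "z \<kappa>" "r \<kappa>" "n \<kappa>"]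
      by simp
  qed simp
  then show ?thesis using assms(2) by (auto simp: coeff_eq_0)
qed

definition top_part :: "'j set \<Rightarrow> nat \<Rightarrow> (('j \<Rightarrow> nat) \<Rightarrow> 'a::zero) \<Rightarrow> ('j \<Rightarrow> nat) \<Rightarrow> 'a" where
  "top_part I k c e = (if sum e I = k then c e else 0)"

text \<open>
  Along the curve \<open>w = t X\<close> the coefficient of the highest possible power of \<open>X\<close> comes from the
  top homogeneous part only, and the translation \<open>z\<close> disappears from it.  This is the step that
  makes the argument independent of which translate of the subspace is rich.
\<close>

lemma top_part_vanishes:
  fixes c :: "('j \<Rightarrow> nat) \<Rightarrow> 'a::idom" and u :: "'j \<Rightarrow> nat \<Rightarrow> 'a"
  assumes I: "finite I" and deg: "total_degree_le I d c k"
    and van: "\<And>w. hasse I d (\<lambda>e. cst (c e)) i (\<lambda>\<kappa>. cst (z \<kappa>) + (\<Sum>j<a. cst (u \<kappa> j) * w j)) = 0"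
  shows "hasse I d (\<lambda>e. [:top_part I k c e:]) i (\<lambda>\<kappa>. \<Sum>j<a. [:u \<kappa> j:] * t j) = 0"
proof (cases "sum i I \<le> k")
  case False
  then show ?thesis
    unfolding hasse_def
  proof (intro sum.neutral ballI)
    fix e assume "e \<in> exponent_box I d"
    have "(\<Prod>\<kappa>\<in>I. of_nat (e \<kappa> choose i \<kappa>) * (\<Sum>j<a. [:u \<kappa> j:] * t j) ^ (e \<kappa> - i \<kappa>)) = 0"
      if s: "sum e I = k"
    proof -
      obtain \<kappa> where "\<kappa> \<in> I" "e \<kappa> < i \<kappa>"
        using False s sum_mono[of I i e] by force
      then show ?thesis by (rule prod_binomial_eq_0[OF I])
    qed
    then show "[:top_part I k c e:] *
        (\<Prod>\<kappa>\<in>I. of_nat (e \<kappa> choose i \<kappa>) * (\<Sum>j<a. [:u \<kappa> j:] * t j) ^ (e \<kappa> - i \<kappa>)) = 0"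
      by (simp add: top_part_def)
  qed
next
  case True
  define r where "r \<kappa> = (\<Sum>j<a. [:u \<kappa> j:] * t j)" for \<kappa>
  have pt: "cst (z \<kappa>) + (\<Sum>j<a. cst (u \<kappa> j) * [:0, t j:]) = [:[:z \<kappa>:], r \<kappa>:]" for \<kappa>
  proof -
    have "(\<Sum>j<n. cst (u \<kappa> j) * [:0, t j:]) = [:0, \<Sum>j<n. [:u \<kappa> j:] * t j:]" for n
      by (induction n) (auto simp: cst_def)
    then show ?thesis by (simp add: cst_def r_def)
  qed
  have "0 = coeff (hasse I d (\<lambda>e. cst (c e)) i (\<lambda>\<kappa>. [:[:z \<kappa>:], r \<kappa>:])) (k - sum i I)"
    using van[of "\<lambda>j. [:0, t j:]"] by (simp only: pt coeff_0)
  also have "\<dots> = hasse I d (\<lambda>e. [:top_part I k c e:]) i r"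
    unfolding hasse_def coeff_sum
  proof (intro sum.cong refl)
    fix e assume e: "e \<in> exponent_box I d"
    have split: "(\<Prod>\<kappa>\<in>I. of_nat (e \<kappa> choose i \<kappa>) * f \<kappa> ^ (e \<kappa> - i \<kappa>)) =
       of_nat (\<Prod>\<kappa>\<in>I. e \<kappa> choose i \<kappa>) * (\<Prod>\<kappa>\<in>I. f \<kappa> ^ (e \<kappa> - i \<kappa>))" for f :: "'j \<Rightarrow> 'b::comm_ring_1"
      by (simp add: prod.distrib of_nat_prod)
    have coeff_cst: "coeff (cst x * (of_nat K * p)) N = [:x:] * (of_nat K * coeff p N)"
      for x :: 'a and K N and p :: "'a poly poly"
      by (simp add: cst_def of_nat_mult_conv_smult) (simp add: mult.commute)
    show "coeff (cst (c e) * (\<Prod>\<kappa>\<in>I. of_nat (e \<kappa> choose i \<kappa>) * [:[:z \<kappa>:], r \<kappa>:] ^ (e \<kappa> - i \<kappa>))) (k - sum i I) =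
       [:top_part I k c e:] * (\<Prod>\<kappa>\<in>I. of_nat (e \<kappa> choose i \<kappa>) * r \<kappa> ^ (e \<kappa> - i \<kappa>))"
    proof (cases "c e = 0 \<or> (\<exists>\<kappa>\<in>I. e \<kappa> < i \<kappa>)")
      case True
      then show ?thesis
      proof
        assume "\<exists>\<kappa>\<in>I. e \<kappa> < i \<kappa>"
        then have "(\<Prod>\<kappa>\<in>I. e \<kappa> choose i \<kappa>) = 0"
          using I by (auto simp: binomial_eq_0 intro!: prod_zero)
        then show ?thesis unfolding split by (simp only: of_nat_0 mult_zero_left mult_zero_right coeff_0)
      qed (simp add: top_part_def cst_def)
    next
      case False
      have s: "(\<Sum>\<kappa>\<in>I. e \<kappa> - i \<kappa>) = sum e I - sum i I" "sum i I \<le> sum e I" "sum e I \<le> k"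
        using sum_diff_exponents[of I i e] False I deg e sum_mono[of I i e]
        by (force simp: total_degree_le_def)+
      have "coeff (\<Prod>\<kappa>\<in>I. [:[:z \<kappa>:], r \<kappa>:] ^ (e \<kappa> - i \<kappa>)) (k - sum i I) =
          (if sum e I = k then (\<Prod>\<kappa>\<in>I. r \<kappa> ^ (e \<kappa> - i \<kappa>)) else 0)"
        using s \<open>sum i I \<le> k\<close> by (subst coeff_prod_linear[OF I]) auto
      then show ?thesis
        unfolding split coeff_cst by (simp add: top_part_def)
    qed
  qed
  finally show ?thesis unfolding r_def by simp
qed

section \<open>Counting vectors and matrices\<close>

lemma add_diff_cancel_mat:
  fixes A C :: "'a::ab_group_add mat"
  assumes "A \<in> carrier_mat m n" "C \<in> carrier_mat m n"
  shows "(A + C) - C = A" "C + (A - C) = A" "(A + C) - A = C" "A - (A - C) = C"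
  using assms by (auto intro!: eq_matI)

lemma bij_betw_vec: "bij_betw (vec n) (PiE {..<n} (\<lambda>_. UNIV)) (carrier_vec n)"
proof (rule bij_betwI[where g = "\<lambda>v. \<lambda>i\<in>{..<n}. v $ i"])
  fix f :: "nat \<Rightarrow> 'a" assume "f \<in> PiE {..<n} (\<lambda>_. UNIV)"
  then show "(\<lambda>i\<in>{..<n}. vec n f $ i) = f"
    by (auto simp: fun_eq_iff restrict_def PiE_def extensional_def)
qed auto

lemma bij_betw_mat:
  "bij_betw (mat m n) (PiE ({..<m} \<times> {..<n}) (\<lambda>_. UNIV)) (carrier_mat m n)"
proof (rule bij_betwI[where g = "\<lambda>A. \<lambda>ij\<in>{..<m} \<times> {..<n}. A $$ ij"])
  fix f :: "nat \<times> nat \<Rightarrow> 'a" assume f: "f \<in> PiE ({..<m} \<times> {..<n}) (\<lambda>_. UNIV)"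
  show "(\<lambda>ij\<in>{..<m} \<times> {..<n}. mat m n f $$ ij) = f"
  proof
    fix ij show "(\<lambda>ij\<in>{..<m} \<times> {..<n}. mat m n f $$ ij) ij = f ij"
      using f by (cases ij) (auto simp: PiE_def extensional_def)
  qed
qed auto

lemma card_carrier_vec: "card (carrier_vec n :: 'a::finite vec set) = CARD('a) ^ n"
  using bij_betw_same_card[OF bij_betw_vec[where 'a = 'a]] by (simp add: card_PiE)

lemma card_carrier_mat: "card (carrier_mat m n :: 'a::finite mat set) = CARD('a) ^ (m * n)"
  using bij_betw_same_card[OF bij_betw_mat[where 'a = 'a]] by (simp add: card_PiE)

lemma finite_carrier_vec [simp, intro]: "finite (carrier_vec n :: 'a::finite vec set)"
  using bij_betw_finite[OF bij_betw_vec[where 'a = 'a]] by (simp add: finite_PiE)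

lemma finite_carrier_mat [simp, intro]: "finite (carrier_mat m n :: 'a::finite mat set)"
  using bij_betw_finite[OF bij_betw_mat[where 'a = 'a]] by (simp add: finite_PiE)

section \<open>A Kakeya bound for shears\<close>

lemma exponent_box_Plus:
  "bij_betw (\<lambda>(e, f). case_sum e f) (exponent_box A d \<times> exponent_box B d) (exponent_box (A <+> B) d)"
proof (rule bij_betwI[where g = "\<lambda>e. (\<lambda>x. e (Inl x), \<lambda>x. e (Inr x))"])
  show "(\<lambda>(e, f). case_sum e f) \<in> exponent_box A d \<times> exponent_box B d \<rightarrow> exponent_box (A <+> B) d"
    by (auto simp: exponent_box_def PiE_def extensional_def split: sum.splits)
  show "(\<lambda>e. (\<lambda>x. e (Inl x), \<lambda>x. e (Inr x))) \<in> exponent_box (A <+> B) d \<rightarrow> exponent_box A d \<times> exponent_box B d"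
    by (auto simp: exponent_box_def PiE_def extensional_def)
qed (auto simp: fun_eq_iff split: sum.splits)

text \<open>
  Fixing the first group of variables at \<open>t\<close> leaves a polynomial in the second group, and
  derivatives in the second group commute with this.
\<close>

lemma hasse_Plus:
  assumes "finite A" "finite B"
  shows "hasse (A <+> B) d c (case_sum (\<lambda>_. 0) i) (case_sum t y) =
    hasse B d (\<lambda>f. \<Sum>e\<in>exponent_box A d. c (case_sum e f) * (\<Prod>k\<in>A. t k ^ e k)) i y"
proof -
  have "hasse (A <+> B) d c (case_sum (\<lambda>_. 0) i) (case_sum t y) =
    (\<Sum>(e, f)\<in>exponent_box A d \<times> exponent_box B d. c (case_sum e f) * ((\<Prod>k\<in>A. t k ^ e k) *
       (\<Prod>k\<in>B. of_nat (f k choose i k) * y k ^ (f k - i k))))"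
    unfolding hasse_def sum.reindex_bij_betw[OF exponent_box_Plus, symmetric]
    using assms by (intro sum.cong refl) (auto simp: prod.Plus)
  also have "\<dots> = (\<Sum>f\<in>exponent_box B d. \<Sum>e\<in>exponent_box A d. c (case_sum e f) * ((\<Prod>k\<in>A. t k ^ e k) *
       (\<Prod>k\<in>B. of_nat (f k choose i k) * y k ^ (f k - i k))))"
    unfolding sum.cartesian_product[symmetric] by (rule sum.swap)
  finally show ?thesis
    by (simp add: hasse_def sum_distrib_right mult.assoc)
qed

text \<open>
  The matrix \<open>B\<close> stands for the subspace \<open>{(h, B h)}\<close>.  Parametrizing subspaces as graphs makes
  the family of subspaces an additive group, on which shears of the ambient space act by
  translation.
\<close>

definition rich_shears :: "nat \<Rightarrow> nat \<Rightarrow> ('a vec \<times> 'a vec) set \<Rightarrow> 'a::{field,finite} mat set" where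
  "rich_shears a b D = {B \<in> carrier_mat b a. \<exists>z\<in>carrier_vec b.
     CARD('a) ^ a \<le> 2 * card {h \<in> carrier_vec a. (h, z + B *\<^sub>v h) \<in> D}}"

text \<open>
  Vanishing to order \<open>m\<close> at one point costs \<open>(m - 1 + N) choose N\<close> conditions.  Relative to the
  number of coefficients in degree \<open>4 q N\<^sup>2\<close>, the conditions at all \<open>q^N\<close> points cost about
  \<open>((m + N) / (4 N\<^sup>2))^N\<close>.  For the lower order this is \<open>(1 - 1 / N)^N \<le> 1 / 2\<close>; for the higher
  order it is \<open>(1 + 2 / N)^N \<le> 9\<close>, but only the part \<open>1 / 20\<close> of the points is concerned, and
  \<open>1 / 2 + 9 / 20 < 1\<close>.
\<close>

lemma vanishing_conditions_bound:
  fixes N q :: nat and D :: real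
  assumes N: "2 \<le> N" and D: "0 \<le> D" "20 * D \<le> real q ^ N" and q: "0 < q"
  shows "D * real ((4 * N\<^sup>2 + 7 * N - 1 + N) choose N) +
    real q ^ N * real ((4 * N\<^sup>2 - 5 * N - 1 + N) choose N) < real ((4 * q * N\<^sup>2 + N) choose N)"
proof -
  define T where "T = real ((4 * q * N\<^sup>2 + N) choose N)"
  have T: "T > 0" by (simp add: T_def)
  have N': "real N > 0" using N by simp
  have NN: "2 * N \<le> N\<^sup>2" using N by (simp add: power2_eq_square)
  have "real ((4 * N\<^sup>2 + 7 * N - 1 + N) choose N) * q ^ N \<le> (1 + 2 / N) ^ N * T"
    unfolding T_def
  proof (rule binomial_scaling)
    show "real (q * (4 * N\<^sup>2 + 7 * N + N)) \<le> (1 + 2 / real N) * real (4 * q * N\<^sup>2)"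
      using N' by (simp add: field_simps power2_eq_square)
  qed (use N in auto)
  also have "(1 + 2 / N) ^ N \<le> exp 2"
    using exp_ge_one_plus_x_over_n_power_n[of N 2] N by simp
  also have "exp (2::real) \<le> 9"
  proof -
    have "exp (2::real) = exp 1 ^ 2" by (simp add: exp_of_nat_mult[symmetric])
    also have "\<dots> \<le> 3 ^ 2" by (intro power_mono exp_le) auto
    finally show ?thesis by simp
  qed
  finally have c1: "real ((4 * N\<^sup>2 + 7 * N - 1 + N) choose N) * q ^ N \<le> 9 * T"
    using T by simp
  have "real ((4 * N\<^sup>2 - 5 * N - 1 + N) choose N) * q ^ N \<le> (1 + (- 1) / N) ^ N * T"
    unfolding T_def
  proof (rule binomial_scaling)
    show "real (q * (4 * N\<^sup>2 - 5 * N + N)) \<le> (1 + (- 1) / N) * real (4 * q * N\<^sup>2)"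
      using N' NN by (simp add: field_simps power2_eq_square of_nat_diff)
  qed (use N NN in auto)
  also have "(1 + (- 1) / N) ^ N \<le> exp (- 1)"
    using exp_ge_one_plus_x_over_n_power_n[of N "- 1"] N by simp
  also have "exp (- 1 :: real) \<le> 1 / 2"
    using exp_ge_add_one_self[of 1] by (simp add: exp_minus field_simps)
  finally have c0: "real q ^ N * real ((4 * N\<^sup>2 - 5 * N - 1 + N) choose N) \<le> T / 2"
    using T by (simp add: mult.commute)
  have "20 * (D * real ((4 * N\<^sup>2 + 7 * N - 1 + N) choose N)) \<le>
      real ((4 * N\<^sup>2 + 7 * N - 1 + N) choose N) * q ^ N"
    using mult_right_mono[OF D(2), of "real ((4 * N\<^sup>2 + 7 * N - 1 + N) choose N)"] by (simp add: mult_ac)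
  then show ?thesis
    using c0 c1 T unfolding T_def[symmetric] by linarith
qed

definition coords :: "'a vec \<times> 'a vec \<Rightarrow> nat + nat \<Rightarrow> 'a" where
  "coords v = case_sum (\<lambda>j. fst v $ j) (\<lambda>r. snd v $ r)"

lemma ex_polynomial_with_prescribed_orders:
  fixes D :: "('a::{field,finite} vec \<times> 'a vec) set"
  assumes D: "D \<subseteq> carrier_vec a \<times> carrier_vec b" and N: "2 \<le> a + b"
    and small: "20 * card D \<le> CARD('a) ^ (a + b)"
  defines "N \<equiv> a + b" and "I \<equiv> {..<a} <+> {..<b}"
  defines "m \<equiv> (\<lambda>v. if v \<in> D then 4 * N\<^sup>2 + 7 * N else 4 * N\<^sup>2 - 5 * N)"
  defines "d \<equiv> 4 * CARD('a) * N\<^sup>2"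
  shows "\<exists>c. (\<exists>e\<in>exponent_box I d. c e \<noteq> 0) \<and> total_degree_le I d c d \<and>
    (\<forall>v\<in>carrier_vec a \<times> carrier_vec b. \<forall>i. sum i I < m v \<longrightarrow> hasse I d c i (coords v) = 0)"
proof -
  let ?V = "carrier_vec a \<times> carrier_vec b :: ('a vec \<times> 'a vec) set"
  let ?q = "CARD('a)"
  define C1 where "C1 = (4 * N\<^sup>2 + 7 * N - 1 + N) choose N"
  define C0 where "C0 = (4 * N\<^sup>2 - 5 * N - 1 + N) choose N"
  have I: "finite I" "card I = N" by (simp_all add: I_def N_def card_Plus)
  have NN: "2 * N \<le> N\<^sup>2" using N unfolding N_def[symmetric] by (simp add: power2_eq_square)
  have V: "finite ?V" "card ?V = ?q ^ N"
    by (simp_all add: card_cartesian_product card_carrier_vec N_def power_add)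
  have cnt: "card {i \<in> PiE I (\<lambda>_. UNIV). sum i I < m v} = (if v \<in> D then C1 else C0)" for v
  proof -
    have "m v \<ge> 1" using N NN by (auto simp: m_def N_def)
    then have "{i \<in> PiE I (\<lambda>_. UNIV). sum i I < m v} = exponents_le I (m v - 1)"
      by (auto simp: exponents_le_def)
    then show ?thesis using I by (simp add: card_exponents_le m_def C1_def C0_def)
  qed
  have "(\<Sum>v\<in>?V. card {i \<in> PiE I (\<lambda>_. UNIV). sum i I < m v}) = card D * C1 + card (?V - D) * C0"
    unfolding cnt using V D by (simp add: sum.If_cases Int_absorb1 Diff_eq)
  also have "\<dots> \<le> card D * C1 + ?q ^ N * C0"
    using V card_mono[of ?V "?V - D"] by simp
  also have "\<dots> < card (exponents_le I d)"
  proof -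
    have "real (card D) * real C1 + real ?q ^ N * real C0 < real ((4 * ?q * N\<^sup>2 + N) choose N)"
      unfolding C1_def C0_def
    proof (rule vanishing_conditions_bound)
      show "20 * real (card D) \<le> real ?q ^ N"
        using small of_nat_mono[of "20 * card D" "?q ^ N", where 'a = real] by (simp add: N_def)
    qed (use N in \<open>auto simp: N_def\<close>)
    then have "real (card D * C1 + ?q ^ N * C0) < real ((d + N) choose N)"
      by (simp add: d_def)
    then show ?thesis using I by (simp only: card_exponents_le of_nat_less_iff)
  qed
  finally show ?thesis
    by (rule ex_polynomial_vanishing[OF V(1) I(1)])
qed

text \<open>
  The two orders average to \<open>4 N\<^sup>2 + N\<close>, which leaves room for derivatives of every order
  \<open>s < N\<close> above the threshold \<open>4 N\<^sup>2\<close> of Schwartz-Zippel.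
\<close>

lemma sum_orders_on_rich_fibre:
  fixes B :: "'a::{field,finite} mat" and z :: "'a vec"
  assumes rich: "CARD('a) ^ a \<le> 2 * card {h \<in> carrier_vec a. (h, z + B *\<^sub>v h) \<in> D}"
    and m: "\<And>v. m v = (if v \<in> D then 4 * N\<^sup>2 + 7 * N else 4 * N\<^sup>2 - 5 * N)" and N: "2 \<le> N" and s: "s < N"
  shows "4 * N\<^sup>2 * CARD('a) ^ a < (\<Sum>h\<in>carrier_vec a. m (h, z + B *\<^sub>v h) - s)"
proof -
  let ?q = "CARD('a) ^ a" and ?R = "{h \<in> carrier_vec a. (h, z + B *\<^sub>v h) \<in> D}"
  have NN: "2 * N \<le> N\<^sup>2" using N by (simp add: power2_eq_square)
  have "(\<Sum>h\<in>carrier_vec a. m (h, z + B *\<^sub>v h) - s) =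
     (\<Sum>h\<in>carrier_vec a. (4 * N\<^sup>2 - 5 * N - s) + (if (h, z + B *\<^sub>v h) \<in> D then 12 * N else 0))"
    using NN s by (intro sum.cong) (auto simp: m)
  also have "\<dots> = ?q * (4 * N\<^sup>2 - 5 * N - s) + card ?R * (12 * N)"
    by (simp add: sum.distrib card_carrier_vec sum.inter_filter[symmetric])
  also have "\<dots> \<ge> ?q * (4 * N\<^sup>2 - 5 * N - s) + ?q * (6 * N)"
    using mult_right_mono[OF rich, of "6 * N"] by (simp add: mult_ac)
  also have "?q * (4 * N\<^sup>2 - 5 * N - s) + ?q * (6 * N) = ?q * (4 * N\<^sup>2 - 5 * N - s + 6 * N)"
    by (simp add: distrib_left)
  finally have le: "?q * (4 * N\<^sup>2 - 5 * N - s + 6 * N) \<le> (\<Sum>h\<in>carrier_vec a. m (h, z + B *\<^sub>v h) - s)" .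
  have "4 * N\<^sup>2 * ?q < ?q * (4 * N\<^sup>2 - 5 * N - s + 6 * N)"
    using NN s by (simp add: mult.commute)
  then show ?thesis using le by (rule less_le_trans)
qed

text \<open>
  The Kronecker point, and the linear combinations of its coordinates with coefficients in the
  field.  The set of these combinations is the side of the grid on which the top part of the
  polynomial vanishes.
\<close>

definition generic :: "nat \<Rightarrow> nat \<Rightarrow> 'a::comm_ring_1 poly" where
  "generic W j = Polynomial.monom 1 (W ^ j)"

definition generic_row :: "nat \<Rightarrow> nat \<Rightarrow> (nat \<Rightarrow> 'a) \<Rightarrow> 'a::comm_ring_1 poly" where
  "generic_row W a \<beta> = (\<Sum>j<a. [:\<beta> j:] * generic W j)"

lemma generic_row_inject:
  assumes "2 \<le> W" and "generic_row W a \<beta> = generic_row W a \<gamma>" and "j < a"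
  shows "\<beta> j = \<gamma> j"
proof -
  have "coeff (generic_row W a \<alpha>) (W ^ j) = \<alpha> j" for \<alpha> :: "nat \<Rightarrow> 'a"
  proof -
    have "coeff (generic_row W a \<alpha>) (W ^ j) = (\<Sum>k<a. if k = j then \<alpha> k else 0)"
      unfolding generic_row_def generic_def coeff_sum using assms(1)
      by (intro sum.cong) (auto simp: smult_monom coeff_monom power_inject_exp)
    then show ?thesis using assms(3) by simp
  qed
  then show ?thesis using arg_cong[OF assms(2), of "\<lambda>p. coeff p (W ^ j)"] by simp
qed

text \<open>
  Let \<open>P\<close> be the polynomial with the prescribed orders and let \<open>k\<close> be its exact degree.  For a rich
  \<open>B\<close> the top part of \<open>P\<close> vanishes to order \<open>N\<close>, with respect to the last \<open>b\<close> variables, at the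
  point \<open>(t, B t)\<close> for the generic \<open>t\<close>.  With the first \<open>a\<close> variables fixed at \<open>t\<close>, the top part is
  a nonzero polynomial \<open>c'\<close> in \<open>b\<close> variables over \<open>'a poly\<close>, because \<open>t\<close> is a Kronecker point, and
  different \<open>B\<close> give different points \<open>B t\<close> of a grid of side \<open>q^a\<close>.  Schwartz-Zippel gives
  \<open>q^a N |R| \<le> 4 q N\<^sup>2 q^(a b)\<close> for the number \<open>|R|\<close> of rich matrices, and
  \<open>q^(a - 1) \<ge> 16 N\<close> turns this into \<open>4 |R| \<le> q^(a b)\<close>.
\<close>

lemma kakeya_for_shears:
  fixes D :: "('a::{field,finite} vec \<times> 'a vec) set"
  assumes D: "D \<subseteq> carrier_vec a \<times> carrier_vec b" and ab: "1 \<le> a" "1 \<le> b"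
    and large: "16 * (a + b) \<le> CARD('a) ^ (a - 1)"
    and small: "20 * card D \<le> CARD('a) ^ (a + b)"
  shows "4 * card (rich_shears a b D) \<le> CARD('a) ^ (a * b)"
proof -
  let ?q = "CARD('a)"
  define N where "N = a + b"
  define I where "I = {..<a} <+> {..<b}"
  define m where "m = (\<lambda>v. if v \<in> D then 4 * N\<^sup>2 + 7 * N else 4 * N\<^sup>2 - 5 * N)"
  define d where "d = 4 * CARD('a) * N\<^sup>2"
  have N: "2 \<le> N" using ab by (simp add: N_def)
  have I: "finite I" by (simp add: I_def)
  have q: "?q > 0" by simp
  have "\<exists>c. (\<exists>e\<in>exponent_box I d. c e \<noteq> 0) \<and> total_degree_le I d c d \<and>
    (\<forall>v\<in>carrier_vec a \<times> carrier_vec b. \<forall>i. sum i I < m v \<longrightarrow> hasse I d c i (coords v) = 0)"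
    unfolding N_def I_def m_def d_def
    by (rule ex_polynomial_with_prescribed_orders[OF D N[unfolded N_def] small])
  then obtain c where c: "\<exists>e\<in>exponent_box I d. c e \<noteq> 0" "total_degree_le I d c d"
    and van: "\<forall>v\<in>carrier_vec a \<times> carrier_vec b. \<forall>i. sum i I < m v \<longrightarrow> hasse I d c i (coords v) = 0"
    by (elim exE conjE)
  \<comment> \<open>the exact degree, so that the top part of degree \<open>k\<close> is nonzero\<close>
  define k where "k = Max ((\<lambda>e. sum e I) ` {e \<in> exponent_box I d. c e \<noteq> 0})"
  have fin: "finite ((\<lambda>e. sum e I) ` {e \<in> exponent_box I d. c e \<noteq> 0})" using I by simp
  have "k \<in> (\<lambda>e. sum e I) ` {e \<in> exponent_box I d. c e \<noteq> 0}"
    unfolding k_def using fin c(1) by (intro Max_in) auto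
  then obtain e0 where e0: "e0 \<in> exponent_box I d" "c e0 \<noteq> 0" "sum e0 I = k" by auto
  have kd: "k \<le> d" using c(2) e0 by (auto simp: total_degree_le_def)
  have degk: "total_degree_le I d c k"
    unfolding total_degree_le_def k_def using fin by auto
  \<comment> \<open>larger than every exponent, as Kronecker substitution requires\<close>
  define W where "W = d + 1"
  have W: "2 \<le> W" "d < W" using N by (auto simp: W_def d_def)
  define row where "row B r = generic_row W a (\<lambda>j. B $$ (r, j))" for B :: "'a mat" and r
  let ?C = "\<lambda>e. [:top_part I k c e:]"
  define c' where "c' f = (\<Sum>e\<in>exponent_box {..<a} d. ?C (case_sum e f) * (\<Prod>j<a. generic W j ^ e j))" for f
  have top_van: "hasse {..<b} d c' i (row B) = 0"
    if B: "B \<in> rich_shears a b D" and i: "sum i {..<b} < N" for B i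
  proof -
    from B obtain z where z: "z \<in> carrier_vec b" and Bc: "B \<in> carrier_mat b a"
      and rich: "?q ^ a \<le> 2 * card {h \<in> carrier_vec a. (h, z + B *\<^sub>v h) \<in> D}"
      unfolding rich_shears_def by blast
    define z' :: "nat + nat \<Rightarrow> 'a" where "z' = case_sum (\<lambda>_. 0) (\<lambda>r. z $ r)"
    define u :: "nat + nat \<Rightarrow> nat \<Rightarrow> 'a" where "u = case_sum (\<lambda>j' j. if j = j' then 1 else 0) (\<lambda>r j. B $$ (r, j))"
    let ?i = "case_sum (\<lambda>_. 0) i :: nat + nat \<Rightarrow> nat"
    have sumi: "sum ?i I = sum i {..<b}" by (simp add: I_def sum.Plus)
    define m' where "m' h = m (vec a h, z + B *\<^sub>v vec a h)" for h
    have pt: "coords (vec a h, z + B *\<^sub>v vec a h) \<kappa> = z' \<kappa> + (\<Sum>j<a. u \<kappa> j * h j)" if "\<kappa> \<in> I" for h \<kappa>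
    proof (cases \<kappa>)
      case (Inl j)
      have "(\<Sum>j'<a. u \<kappa> j' * h j') = (\<Sum>j'<a. if j' = j then h j' else 0)"
        by (intro sum.cong) (auto simp: Inl u_def)
      then show ?thesis using Inl that by (auto simp: I_def z'_def coords_def)
    next
      case (Inr r)
      then have "r < b" using that by (auto simp: I_def)
      then show ?thesis using Inr Bc z
        by (simp add: z'_def u_def coords_def scalar_prod_def lessThan_atLeast0)
    qed
    have "hasse I d (\<lambda>e. cst (c e)) ?i (\<lambda>\<kappa>. cst (z' \<kappa>) + (\<Sum>j<a. cst (u \<kappa> j) * w j)) = 0" for w
    proof (rule affine_restriction_vanishes[where m = m' and z = z' and u = u and w = w and a = a and i = ?i, OF I degk])
      fix h i' assume "h \<in> PiE {..<a} (\<lambda>_. UNIV :: 'a set)" and i': "sum i' I < m' h"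
      have "hasse I d c i' (coords (vec a h, z + B *\<^sub>v vec a h)) = 0"
        using i' z Bc unfolding m'_def by (intro van[rule_format]) auto
      moreover have "hasse I d c i' (\<lambda>\<kappa>. z' \<kappa> + (\<Sum>j<a. u \<kappa> j * h j)) =
          hasse I d c i' (coords (vec a h, z + B *\<^sub>v vec a h))"
        by (rule hasse_cong) (simp_all only: pt)
      ultimately show "hasse I d c i' (\<lambda>\<kappa>. z' \<kappa> + (\<Sum>j<a. u \<kappa> j * h j)) = 0"
        by simp
    next
      \<comment> \<open>the total order on the rich translate exceeds what degree \<open>d = 4 q N\<^sup>2\<close> allows\<close>
      have "4 * N\<^sup>2 * ?q ^ a < (\<Sum>h\<in>carrier_vec a. m (h, z + B *\<^sub>v h) - sum ?i I)"
      proof (rule sum_orders_on_rich_fibre[where m = m and s = "sum ?i I", OF rich _ N])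
        show "m v = (if v \<in> D then 4 * N\<^sup>2 + 7 * N else 4 * N\<^sup>2 - 5 * N)" for v
          unfolding m_def by (rule refl)
        show "sum ?i I < N" unfolding sumi by (rule i)
      qed
      note fibre = this
      have "(k - sum ?i I) * ?q ^ a \<le> d * ?q ^ a"
        using kd by (intro mult_right_mono) auto
      also have "\<dots> = ?q * (4 * N\<^sup>2 * ?q ^ a)"
        unfolding d_def by (simp only: mult_ac)
      also have "\<dots> < ?q * (\<Sum>h\<in>PiE {..<a} (\<lambda>_. UNIV). m' h - sum ?i I)"
        using q fibre unfolding m'_def
        by (subst sum.reindex_bij_betw[OF bij_betw_vec, of "\<lambda>h. m (h, z + B *\<^sub>v h) - sum ?i I"]) simp
      finally show "(k - sum ?i I) * ?q ^ a < ?q * (\<Sum>h\<in>PiE {..<a} (\<lambda>_. UNIV). m' h - sum ?i I)" .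
    qed
    then have top0: "hasse I d ?C ?i (\<lambda>\<kappa>. \<Sum>j<a. [:u \<kappa> j:] * generic W j) = 0"
      by (rule top_part_vanishes[where z = z' and u = u and i = ?i and t = "generic W", OF I degk])
    have "hasse I d ?C ?i (case_sum (generic W) (row B)) =
        hasse I d ?C ?i (\<lambda>\<kappa>. \<Sum>j<a. [:u \<kappa> j:] * generic W j)"
    proof (rule hasse_cong)
      fix \<kappa> assume "\<kappa> \<in> I"
      then show "case_sum (generic W) (row B) \<kappa> = (\<Sum>j<a. [:u \<kappa> j:] * generic W j)"
      proof (cases \<kappa>)
        case (Inl j)
        have "(\<Sum>j'<a. [:u \<kappa> j':] * generic W j') = (\<Sum>j'<a. if j' = j then generic W j' else 0 :: 'a poly)"
          by (intro sum.cong) (auto simp: Inl u_def)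
        then show ?thesis using Inl \<open>\<kappa> \<in> I\<close> by (auto simp: I_def)
      next
        case (Inr r)
        then show ?thesis by (simp add: u_def row_def generic_row_def)
      qed
    qed auto
    also note top0
    finally show ?thesis
      unfolding I_def c'_def hasse_Plus[OF finite_lessThan finite_lessThan] .
  qed
  define T :: "'a poly set" where "T = generic_row W a ` PiE {..<a} (\<lambda>_. UNIV :: 'a set)"
  have T: "finite T" "card T = ?q ^ a"
  proof -
    have "inj_on (generic_row W a) (PiE {..<a} (\<lambda>_. UNIV :: 'a set))"
      by (intro inj_onI PiE_ext) (auto intro: generic_row_inject[OF W(1)])
    then show "card T = ?q ^ a" by (simp add: T_def card_image card_PiE)
  qed (simp add: T_def finite_PiE)
  define Y where "Y = (\<lambda>B. restrict (row B) {..<b}) ` rich_shears a b D"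
  have rs: "rich_shears a b D \<subseteq> carrier_mat b a" by (auto simp: rich_shears_def)
  have row_T: "row B r \<in> T" for B r
    unfolding T_def row_def
    by (rule image_eqI[of _ _ "restrict (\<lambda>j. B $$ (r, j)) {..<a}"]) (auto simp: generic_row_def)
  have Y: "Y \<subseteq> PiE {..<b} (\<lambda>_. T)" unfolding Y_def by (intro image_subsetI) (simp add: restrict_PiE_iff row_T)
  have cardY: "card Y = card (rich_shears a b D)"
    unfolding Y_def
  proof (intro card_image inj_onI)
    fix A B assume AB: "A \<in> rich_shears a b D" "B \<in> rich_shears a b D"
      and eq: "restrict (row A) {..<b} = restrict (row B) {..<b}"
    have "A $$ (r, j) = B $$ (r, j)" if "r < b" "j < a" for r j
      using fun_cong[OF eq, of r] that generic_row_inject[OF W(1), of a "\<lambda>j. A $$ (r, j)" "\<lambda>j. B $$ (r, j)" j]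
      by (simp add: row_def)
    then show "A = B" using subsetD[OF rs AB(1)] subsetD[OF rs AB(2)] by (intro eq_matI) auto
  qed
  have sz: "card T * (\<Sum>x\<in>PiE {..<b} (\<lambda>_. T). if x \<in> Y then N else 0) \<le> k * card T ^ card {..<b}"
  proof (rule schwartz_zippel_multiplicity[where c = c' and d = d])
    obtain e f where ef: "e0 = case_sum e f" "e \<in> exponent_box {..<a} d" "f \<in> exponent_box {..<b} d"
      using e0(1) bij_betw_imp_surj_on[OF exponent_box_Plus, of "{..<a}" d "{..<b}"] unfolding I_def by force
    have "c' f \<noteq> 0"
    proof
      assume "c' f = 0"
      then have "top_part I k c (case_sum e f) = 0"
        unfolding c'_def generic_def
        by (intro kronecker_zero[where g = "\<lambda>e. top_part I k c (case_sum e f)", OF _ subset_refl W(2)]) (use ef in auto)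
      then show False using e0 ef by (simp add: top_part_def)
    qed
    then show "\<exists>f\<in>exponent_box {..<b} d. c' f \<noteq> 0" using ef by blast
    show "total_degree_le {..<b} d c' k"
      unfolding total_degree_le_def
    proof (intro ballI impI)
      fix f assume "c' f \<noteq> 0"
      then obtain e where "?C (case_sum e f) * (\<Prod>j<a. generic W j ^ e j) \<noteq> 0"
        unfolding c'_def by (rule sum.not_neutral_contains_not_neutral)
      then have "sum (case_sum e f) I = k" by (auto simp: top_part_def split: if_splits)
      then show "sum f {..<b} \<le> k" by (simp add: I_def sum.Plus)
    qed
    fix x i assume "sum i {..<b} < (if x \<in> Y then N else 0)"
    then obtain B where B: "B \<in> rich_shears a b D" "x = restrict (row B) {..<b}" "sum i {..<b} < N"
      by (auto simp: Y_def split: if_splits)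
    then show "hasse {..<b} d c' i x = 0"
      using top_van[OF B(1,3)] hasse_cong[of "{..<b}" d c' c' i i x "row B"] by simp
  qed (use T in auto)
  have "?q ^ a * (card Y * N) = card T * (\<Sum>x\<in>PiE {..<b} (\<lambda>_. T). if x \<in> Y then N else 0)"
    using Y T by (simp add: sum.If_cases finite_PiE Int_absorb1)
  also note sz
  also have "k * card T ^ card {..<b} \<le> 4 * ?q * N\<^sup>2 * ?q ^ (a * b)"
    using kd T by (simp add: d_def power_mult)
  finally have main: "?q ^ a * (card Y * N) \<le> 4 * ?q * N\<^sup>2 * ?q ^ (a * b)" .
  have "(4 * ?q * N\<^sup>2) * (4 * card Y) = ?q * (16 * N) * (card Y * N)"
    by (simp add: power2_eq_square)
  also have "\<dots> \<le> ?q * ?q ^ (a - 1) * (card Y * N)"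
    using large by (intro mult_right_mono mult_left_mono) (auto simp: N_def)
  also have "\<dots> = ?q ^ a * (card Y * N)"
    using ab by (simp add: power_eq_if)
  also note main
  finally show ?thesis using N q by (simp add: cardY)
qed

section \<open>The maximal inequality for sparse sets\<close>

text \<open>
  If every point lies in at least \<open>k\<close> of the sets, some set covers at least the proportion
  \<open>k / card G\<close> of the points that are still uncovered.
\<close>

lemma greedy_cover:
  assumes X: "finite X" and G: "finite G" and k: "\<And>x. x \<in> X \<Longrightarrow> k \<le> card {C \<in> G. x \<in> T C}"
  shows "\<exists>F\<subseteq>G. card F \<le> r \<and> card G ^ r * card (X - \<Union>(T ` F)) \<le> (card G - k) ^ r * card X"
proof (induction r)
  case 0
  show ?case by (intro exI[of _ "{}"]) auto
next
  case (Suc r)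
  then obtain F where F: "F \<subseteq> G" "card F \<le> r" "card G ^ r * card (X - \<Union>(T ` F)) \<le> (card G - k) ^ r * card X"
    by blast
  define U where "U = X - \<Union>(T ` F)"
  have U: "finite U" "U \<subseteq> X" using X by (auto simp: U_def)
  show ?case
  proof (cases "G = {}")
    case True
    then show ?thesis by (intro exI[of _ "{}"]) auto
  next
    case False
    have "k * card U \<le> (\<Sum>x\<in>U. card {C \<in> G. x \<in> T C})"
      using sum_mono[of U "\<lambda>_. k" "\<lambda>x. card {C \<in> G. x \<in> T C}"] k U by (auto simp: mult.commute)
    also have "\<dots> = (\<Sum>C\<in>G. card {x \<in> U. x \<in> T C})"
      using sum_multicount_gen[OF U(1) G, of "\<lambda>x C. x \<in> T C" "\<lambda>C. card {x \<in> U. x \<in> T C}"] by simp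
    finally have avg: "k * card U \<le> (\<Sum>C\<in>G. card {x \<in> U. x \<in> T C})" .
    have "\<exists>C\<in>G. k * card U \<le> card G * card {x \<in> U. x \<in> T C}"
    proof (rule ccontr)
      assume "\<not> ?thesis"
      then have "(\<Sum>C\<in>G. card G * card {x \<in> U. x \<in> T C}) < (\<Sum>C\<in>G. k * card U)"
        using False G by (intro sum_strict_mono) (auto simp: not_le)
      then show False using avg False G by (simp add: sum_distrib_left[symmetric])
    qed
    then obtain C where C: "C \<in> G" "k * card U \<le> card G * card {x \<in> U. x \<in> T C}" by blast
    have un: "X - \<Union>(T ` insert C F) = U - {x \<in> U. x \<in> T C}" by (auto simp: U_def)
    have "card G * card (X - \<Union>(T ` insert C F)) = card G * card U - card G * card {x \<in> U. x \<in> T C}"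
      unfolding un using U by (subst card_Diff_subset) (auto simp: diff_mult_distrib2)
    also have "\<dots> \<le> (card G - k) * card U"
      using C(2) unfolding diff_mult_distrib by (rule diff_le_mono2)
    finally have step: "card G * card (X - \<Union>(T ` insert C F)) \<le> (card G - k) * card U" .
    have "card G ^ Suc r * card (X - \<Union>(T ` insert C F)) \<le> card G ^ r * ((card G - k) * card U)"
      using mult_left_mono[OF step, of "card G ^ r"] by (simp add: mult_ac)
    also have "\<dots> = (card G - k) * (card G ^ r * card U)" by (simp add: mult_ac)
    also have "\<dots> \<le> (card G - k) * ((card G - k) ^ r * card X)"
      using F(3) unfolding U_def by (rule mult_left_mono) simp
    finally have "card G ^ Suc r * card (X - \<Union>(T ` insert C F)) \<le> (card G - k) ^ Suc r * card X"
      by (simp add: mult_ac)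
    moreover have "card (insert C F) \<le> Suc r"
      using F(2) card_insert_le_m1[of "Suc r" F C] by simp
    ultimately show ?thesis using F(1) C(1) by (intro exI[of _ "insert C F"]) auto
  qed
qed

text \<open>
  A form of Bernoulli's inequality that turns a bound on the uncovered proportion after \<open>r\<close>
  steps into a bound on \<open>r p\<close>.
\<close>

lemma one_minus_power_le:
  fixes p :: real
  assumes "0 \<le> p" "p \<le> 1"
  shows "(1 - p) ^ r * (1 + r * p) \<le> 1"
proof -
  have "(1 - p) ^ r * (1 + r * p) \<le> (1 - p) ^ r * (1 + p) ^ r"
    using assms Bernoulli_inequality[of p r] by (intro mult_left_mono) auto
  also have "\<dots> = (1 - p\<^sup>2) ^ r"
    by (simp add: power_mult_distrib[symmetric] algebra_simps power2_eq_square)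
  also have "\<dots> \<le> 1"
    using assms by (intro power_le_one) (auto simp: power_le_one)
  finally show ?thesis .
qed

definition shear :: "'a::comm_ring_1 mat \<Rightarrow> 'a vec \<times> 'a vec \<Rightarrow> 'a vec \<times> 'a vec" where
  "shear C v = (fst v, snd v + C *\<^sub>v fst v)"

lemma rich_shears_shear:
  assumes D: "D \<subseteq> carrier_vec a \<times> carrier_vec b" and B: "B \<in> rich_shears a b D"
    and C: "C \<in> carrier_mat b a" and sub: "shear C ` D \<subseteq> D'" "D' \<subseteq> carrier_vec a \<times> carrier_vec b"
  shows "B + C \<in> rich_shears a b D'"
proof -
  from B obtain z where z: "z \<in> carrier_vec b" and Bc: "B \<in> carrier_mat b a"
    and rich: "CARD('a) ^ a \<le> 2 * card {h \<in> carrier_vec a. (h, z + B *\<^sub>v h) \<in> D}"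
    unfolding rich_shears_def by blast
  have "{h \<in> carrier_vec a. (h, z + B *\<^sub>v h) \<in> D} \<subseteq> {h \<in> carrier_vec a. (h, z + (B + C) *\<^sub>v h) \<in> D'}"
  proof clarify
    fix h assume h: "h \<in> carrier_vec a" "(h, z + B *\<^sub>v h) \<in> D"
    have "shear C (h, z + B *\<^sub>v h) = (h, z + (B + C) *\<^sub>v h)"
      using h z Bc C by (simp add: shear_def add_mult_distrib_mat_vec[of _ b a] assoc_add_vec[of _ b])
    then show "(h, z + (B + C) *\<^sub>v h) \<in> D'" using sub h by (metis imageI subsetD)
  qed
  then have "card {h \<in> carrier_vec a. (h, z + B *\<^sub>v h) \<in> D} \<le> card {h \<in> carrier_vec a. (h, z + (B + C) *\<^sub>v h) \<in> D'}"
    by (intro card_mono) auto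
  then show ?thesis
    using rich z Bc C unfolding rich_shears_def by (auto intro!: bexI[of _ z])
qed

lemma card_translates_containing:
  fixes X :: "'a::{field,finite} mat set"
  assumes X: "X \<subseteq> carrier_mat b a" and A: "A \<in> carrier_mat b a"
  shows "card {C \<in> carrier_mat b a. A \<in> (\<lambda>B. B + C) ` X} = card X"
proof -
  have canc: "B + (A - B) = A" if "B \<in> carrier_mat b a" for B
    using that A by (rule add_diff_cancel_mat(2)[rotated])
  have canc': "(B + C) - B = C" if "B \<in> carrier_mat b a" "C \<in> carrier_mat b a" for B C :: "'a mat"
    using that by (rule add_diff_cancel_mat(3))
  have "{C \<in> carrier_mat b a. A \<in> (\<lambda>B. B + C) ` X} = (\<lambda>B. A - B) ` X"
  proof (intro equalityI subsetI)
    fix C assume "C \<in> {C \<in> carrier_mat b a. A \<in> (\<lambda>B. B + C) ` X}"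
    then obtain B where "B \<in> X" "C \<in> carrier_mat b a" "A = B + C" by auto
    then show "C \<in> (\<lambda>B. A - B) ` X" using X canc'[of B C] by (auto intro!: image_eqI[of _ _ B])
  next
    fix C assume "C \<in> (\<lambda>B. A - B) ` X"
    then obtain B where B: "B \<in> X" "C = A - B" by auto
    then have "B \<in> carrier_mat b a" using X by blast
    then show "C \<in> {C \<in> carrier_mat b a. A \<in> (\<lambda>B. B + C) ` X}"
      using B A canc[of B] by (auto intro!: image_eqI[of _ _ B])
  qed
  moreover have "inj_on (\<lambda>B. A - B) X"
  proof (rule inj_onI)
    fix B B' assume "B \<in> X" "B' \<in> X" and eq: "A - B = A - B'"
    then have c: "B \<in> carrier_mat b a" "B' \<in> carrier_mat b a" using X by auto
    have "A - (A - B) = B" "A - (A - B') = B'" using c A by (auto intro: add_diff_cancel_mat(4))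
    then show "B = B'" using eq by metis
  qed
  ultimately show ?thesis by (simp add: card_image)
qed

text \<open>
  For a set \<open>D\<close> of density \<open>\<rho>\<close> there is room for the union \<open>D'\<close> of about \<open>1 / (20 \<rho>)\<close>
  sheared copies of \<open>D\<close>.  If the proportion \<open>p\<close> of rich matrices were much larger than \<open>\<rho>\<close>, then
  suitable copies would make more than a quarter of all matrices rich for \<open>D'\<close>.
\<close>

lemma kakeya_maximal_shears:
  fixes D :: "('a::{field,finite} vec \<times> 'a vec) set"
  assumes D: "D \<subseteq> carrier_vec a \<times> carrier_vec b" and ab: "1 \<le> a" "1 \<le> b"
    and large: "16 * (a + b) \<le> CARD('a) ^ (a - 1)"
  shows "card (rich_shears a b D) * CARD('a) ^ (a + b) \<le> 40 * card D * CARD('a) ^ (a * b)"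
proof -
  let ?q = "CARD('a)" and ?X = "carrier_mat b a :: 'a mat set" and ?R = "rich_shears a b D"
  define Q where "Q = ?q ^ (a + b)"
  have X: "card ?X = ?q ^ (a * b)" by (simp add: card_carrier_mat mult.commute)
  have R: "?R \<subseteq> ?X" by (auto simp: rich_shears_def)
  then have Rle: "card ?R \<le> card ?X" by (intro card_mono) auto
  have Qpos: "Q > 0" by (simp add: Q_def)
  have finD: "finite D" by (rule finite_subset[OF D]) auto
  consider "Q < 40 * card D" | "D = {}" | "40 * card D \<le> Q" "D \<noteq> {}" by linarith
  then show ?thesis
  proof cases
    case 1
    then have "card ?R * Q \<le> card ?X * (40 * card D)" using Rle by (intro mult_mono) auto
    then show ?thesis by (simp add: Q_def X mult_ac)
  next
    case 2
    then have "?R = {}" by (auto simp: rich_shears_def)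
    then show ?thesis by simp
  next
    case 3
    have dpos: "card D > 0" using 3 finD by (simp add: card_gt_0_iff)
    \<comment> \<open>the largest number of copies for which the density \<open>1/20\<close> is guaranteed\<close>
    define r where "r = Q div (20 * card D)"
    have r: "r * (20 * card D) \<le> Q" "Q < (r + 1) * (20 * card D)"
      using dpos by (simp_all add: r_def dividend_less_div_times div_times_less_eq_dividend)
    have "\<exists>F\<subseteq>?X. card F \<le> r \<and> card ?X ^ r * card (?X - \<Union>((\<lambda>C. (\<lambda>B. B + C) ` ?R) ` F)) \<le> (card ?X - card ?R) ^ r * card ?X"
      by (rule greedy_cover) (auto simp: card_translates_containing[OF R])
    then obtain F where F: "F \<subseteq> ?X" "card F \<le> r"
      and cover: "card ?X ^ r * card (?X - \<Union>((\<lambda>C. (\<lambda>B. B + C) ` ?R) ` F)) \<le> (card ?X - card ?R) ^ r * card ?X"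
      by blast
    define U where "U = \<Union>((\<lambda>C. (\<lambda>B. B + C) ` ?R) ` F)"
    define D' where "D' = (\<Union>C\<in>F. shear C ` D)"
    have finF: "finite F" by (rule finite_subset[OF F(1)]) auto
    have D': "D' \<subseteq> carrier_vec a \<times> carrier_vec b"
      using D F(1) by (fastforce simp: D'_def shear_def)
    have "card D' \<le> (\<Sum>C\<in>F. card (shear C ` D))"
      unfolding D'_def using finF by (rule card_UN_le)
    also have "\<dots> \<le> (\<Sum>C\<in>F. card D)"
      by (intro sum_mono card_image_le finD)
    also have "\<dots> \<le> r * card D" using F(2) by simp
    finally have "20 * card D' \<le> Q" using r(1) by simp
    then have "4 * card (rich_shears a b D') \<le> card ?X"
      using kakeya_for_shears[OF D' ab large] by (simp add: Q_def X)
    moreover have "U \<subseteq> rich_shears a b D'"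
    proof -
      have "B + C \<in> rich_shears a b D'" if "C \<in> F" "B \<in> ?R" for B C
        using rich_shears_shear[OF D that(2) _ _ D', of C] that(1) F(1) by (auto simp: D'_def)
      then show ?thesis by (auto simp: U_def)
    qed
    moreover have "finite (rich_shears a b D')"
      by (rule finite_subset[of _ ?X]) (auto simp: rich_shears_def)
    ultimately have "4 * card U \<le> card ?X"
      using card_mono[of "rich_shears a b D'" U] by linarith
    moreover have "U \<subseteq> ?X" using F(1) R by (fastforce simp: U_def)
    ultimately have unc: "3 * card ?X \<le> 4 * card (?X - U)"
      by (subst card_Diff_subset) (auto intro: finite_subset[of _ ?X])
    define p where "p = real (card ?R) / real (card ?X)"
    have Xpos: "real (card ?X) > 0" by (simp add: X)
    have p: "0 \<le> p" "p \<le> 1"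
    proof -
      show "0 \<le> p" by (simp add: p_def)
      show "p \<le> 1" unfolding p_def divide_le_eq_1_pos[OF Xpos] of_nat_le_iff by (rule Rle)
    qed
    have Xp: "real (card ?X) * p = real (card ?R)"
      unfolding p_def using Xpos by (simp only: times_divide_eq_right) (simp only: nonzero_mult_div_cancel_left less_imp_neq[symmetric] not_False_eq_True)
    have "real (card ?X) ^ r * (3 * real (card ?X)) \<le> real (card ?X) ^ r * (4 * real (card (?X - U)))"
      using unc of_nat_mono[OF unc, where 'a = real] by (intro mult_left_mono) auto
    also have "\<dots> \<le> 4 * (real (card ?X - card ?R) ^ r * real (card ?X))"
      using of_nat_mono[OF cover, where 'a = real] by (simp add: U_def)
    also have "real (card ?X - card ?R) = real (card ?X) * (1 - p)"
      using Xp by (simp only: of_nat_diff[OF Rle] right_diff_distrib mult_1_right)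
    finally have "real (card ?X) ^ r * real (card ?X) * 3 \<le> real (card ?X) ^ r * real (card ?X) * (4 * (1 - p) ^ r)"
      by (simp add: power_mult_distrib mult_ac)
    then have "3 \<le> 4 * (1 - p) ^ r"
      using Xpos by (subst (asm) mult_le_cancel_left_pos) auto
    then have "3 * (1 + r * p) \<le> 4 * ((1 - p) ^ r * (1 + r * p))"
      using mult_right_mono[of 3 "4 * (1 - p) ^ r" "1 + r * p"] p by simp
    also have "\<dots> \<le> 4" using one_minus_power_le[OF p, of r] by simp
    finally have rp: "r * p \<le> 1 / 3" by simp
    \<comment> \<open>rounding down loses at most a factor 2, because \<open>Q\<close> is at least \<open>40 * card D\<close>\<close>
    have "Q \<le> 40 * card D * r"
      using r(2) 3(1) by (simp add: algebra_simps)
    then have "real Q * p \<le> (40 * real (card D) * real r) * p"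
      using p(1) by (intro mult_right_mono) (metis of_nat_le_iff of_nat_mult of_nat_numeral, auto)
    also have "\<dots> = 40 * real (card D) * (r * p)" by simp
    also have "\<dots> \<le> 40 * real (card D) * 1" using rp by (intro mult_left_mono) auto
    finally have "real (card ?R) * real Q \<le> 40 * card D * real (card ?X)"
      using Xpos by (simp add: p_def field_simps)
    then have "real (card ?R * Q) \<le> real (40 * card D * card ?X)" by simp
    then show ?thesis unfolding of_nat_le_iff X Q_def .
  qed
qed

section \<open>Second moments of linear hashing\<close>

text \<open>
  The sum of squares of the cell sizes counts colliding pairs, and pairs of different points
  collide with probability at most \<open>1 / card V\<close>.  Summing over all cells instead of estimating single
  cells is what makes this work for linear maps, where the images of points on a common line through
  the origin are not independent.
\<close>

lemma universal_hashing_variance: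
  fixes hash :: "'w \<Rightarrow> 'x \<Rightarrow> 'v"
  assumes fin: "finite \<Omega>" "finite S" "finite V" "V \<noteq> {}"
    and range: "\<And>\<omega> x. \<omega> \<in> \<Omega> \<Longrightarrow> x \<in> S \<Longrightarrow> hash \<omega> x \<in> V"
    and coll: "\<And>x y. x \<in> S \<Longrightarrow> y \<in> S \<Longrightarrow> x \<noteq> y \<Longrightarrow>
        card {\<omega> \<in> \<Omega>. hash \<omega> x = hash \<omega> y} * card V \<le> card \<Omega>"
  shows "(\<Sum>\<omega>\<in>\<Omega>. \<Sum>v\<in>V. (real (card {x \<in> S. hash \<omega> x = v}) - card S / card V)\<^sup>2) \<le> real (card \<Omega>) * card S"
proof -
  define f where "f \<omega> v = real (card {x \<in> S. hash \<omega> x = v})" for \<omega> v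
  define s where "s = real (card S)"
  define n where "n = real (card V)"
  define W where "W = real (card \<Omega>)"
  have n: "n > 0" using fin by (simp add: card_gt_0_iff n_def)
  have f_sum: "(\<Sum>v\<in>V. f \<omega> v) = s" if "\<omega> \<in> \<Omega>" for \<omega>
    using sum.group[of S V "hash \<omega>" "\<lambda>_. 1 :: real"] fin range[OF that]
    unfolding f_def s_def by (simp add: image_subset_iff)
  have f_sq: "(\<Sum>v\<in>V. (f \<omega> v)\<^sup>2) = (\<Sum>x\<in>S. f \<omega> (hash \<omega> x))" if "\<omega> \<in> \<Omega>" for \<omega>
  proof -
    have "(f \<omega> v)\<^sup>2 = (\<Sum>x\<in>{x \<in> S. hash \<omega> x = v}. f \<omega> (hash \<omega> x))" for v
      by (simp add: f_def power2_eq_square)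
    then show ?thesis
      using sum.group[of S V "hash \<omega>" "\<lambda>x. f \<omega> (hash \<omega> x)"] fin range[OF that]
      by (simp add: image_subset_iff)
  qed
  have "(\<Sum>v\<in>V. (f \<omega> v - s / n)\<^sup>2) = (\<Sum>x\<in>S. f \<omega> (hash \<omega> x)) - s\<^sup>2 / n" if "\<omega> \<in> \<Omega>" for \<omega>
  proof -
    have "(\<Sum>v\<in>V. (f \<omega> v - s / n)\<^sup>2) = (\<Sum>v\<in>V. (f \<omega> v)\<^sup>2) - 2 * (s / n) * (\<Sum>v\<in>V. f \<omega> v) + n * (s / n)\<^sup>2"
      by (simp add: power2_diff sum.distrib sum_subtractf sum_distrib_left sum_divide_distrib n_def mult_ac)
    also have "\<dots> = (\<Sum>x\<in>S. f \<omega> (hash \<omega> x)) - s\<^sup>2 / n"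
      using n unfolding f_sum[OF that] f_sq[OF that] by (simp add: power2_eq_square)
    finally show ?thesis .
  qed
  then have "(\<Sum>\<omega>\<in>\<Omega>. \<Sum>v\<in>V. (f \<omega> v - s / n)\<^sup>2) = (\<Sum>\<omega>\<in>\<Omega>. \<Sum>x\<in>S. f \<omega> (hash \<omega> x)) - W * (s\<^sup>2 / n)"
    by (simp add: sum_subtractf W_def)
  also have "(\<Sum>\<omega>\<in>\<Omega>. \<Sum>x\<in>S. f \<omega> (hash \<omega> x)) = (\<Sum>x\<in>S. \<Sum>y\<in>S. real (card {\<omega> \<in> \<Omega>. hash \<omega> y = hash \<omega> x}))"
  proof -
    have "(\<Sum>\<omega>\<in>\<Omega>. f \<omega> (hash \<omega> x)) = (\<Sum>y\<in>S. real (card {\<omega> \<in> \<Omega>. hash \<omega> y = hash \<omega> x}))" for x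
    proof -
      have "(\<Sum>\<omega>\<in>\<Omega>. f \<omega> (hash \<omega> x)) = (\<Sum>\<omega>\<in>\<Omega>. \<Sum>y\<in>S. if hash \<omega> y = hash \<omega> x then 1 else 0)"
        unfolding f_def using fin by (simp add: sum.inter_filter[symmetric])
      also have "\<dots> = (\<Sum>y\<in>S. \<Sum>\<omega>\<in>\<Omega>. if hash \<omega> y = hash \<omega> x then 1 else 0)" by (rule sum.swap)
      finally show ?thesis using fin by (simp add: sum.inter_filter[symmetric])
    qed
    then show ?thesis by (subst sum.swap) simp
  qed
  also have "\<dots> \<le> (\<Sum>x\<in>S. \<Sum>y\<in>S. (if y = x then W else 0) + W / n)"
  proof (intro sum_mono)
    fix x y assume "x \<in> S" "y \<in> S"
    show "real (card {\<omega> \<in> \<Omega>. hash \<omega> y = hash \<omega> x}) \<le> (if y = x then W else 0) + W / n"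
    proof (cases "y = x")
      case True
      then show ?thesis using n by (simp add: W_def)
    next
      case False
      have "real (card {\<omega> \<in> \<Omega>. hash \<omega> y = hash \<omega> x} * card V) \<le> W"
        unfolding W_def of_nat_le_iff using \<open>x \<in> S\<close> \<open>y \<in> S\<close> False by (intro coll)
      then show ?thesis using n False by (simp add: n_def field_simps)
    qed
  qed
  also have "\<dots> = W * s + W * (s\<^sup>2 / n)"
    using fin by (simp add: sum.distrib s_def power2_eq_square algebra_simps)
  finally show ?thesis by (simp add: f_def s_def n_def W_def)
qed

text \<open>
  Chebyshev's inequality, summed over all cells.
\<close>

lemma card_deviations:
  fixes F :: "'w \<Rightarrow> 'v \<Rightarrow> real" and t :: real
  assumes fin: "finite \<Omega>" "finite V" and t: "0 \<le> t"
    and var: "(\<Sum>\<omega>\<in>\<Omega>. \<Sum>v\<in>V. (F \<omega> v - c)\<^sup>2) \<le> M"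
  shows "(\<Sum>\<omega>\<in>\<Omega>. real (card {v \<in> V. t \<le> \<bar>F \<omega> v - c\<bar>})) * t\<^sup>2 \<le> M"
proof -
  have "(\<Sum>\<omega>\<in>\<Omega>. real (card {v \<in> V. t \<le> \<bar>F \<omega> v - c\<bar>})) * t\<^sup>2 =
      (\<Sum>\<omega>\<in>\<Omega>. \<Sum>v\<in>V. if t \<le> \<bar>F \<omega> v - c\<bar> then t\<^sup>2 else 0)"
    using fin by (simp add: sum_distrib_right sum.inter_filter[symmetric])
  also have "\<dots> \<le> (\<Sum>\<omega>\<in>\<Omega>. \<Sum>v\<in>V. (F \<omega> v - c)\<^sup>2)"
    using t by (intro sum_mono) (auto simp: abs_le_square_iff[symmetric])
  finally show ?thesis using var by linarith
qed

text \<open>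
  For \<open>w\<close> with \<open>w $ k \<noteq> 0\<close>, changing column \<open>k\<close> of \<open>H\<close> shifts the value at \<open>w\<close> by an arbitrary
  vector, so each of the \<open>q^a\<close> values is taken equally often.
\<close>

lemma card_matrices_vanishing_at:
  fixes w :: "'a::{field,finite} vec"
  assumes w: "w \<in> carrier_vec n" "w \<noteq> 0\<^sub>v n"
  shows "card {H \<in> carrier_mat a n. H *\<^sub>v w = 0\<^sub>v a} * CARD('a) ^ a \<le> CARD('a) ^ (a * n)"
proof -
  obtain k where k: "k < n" "w $ k \<noteq> 0"
    using w by (auto simp: vec_eq_iff)
  \<comment> \<open>the matrix supported on column \<open>k\<close> that maps \<open>w\<close> to \<open>h\<close>\<close>
  define E where "E h = mat a n (\<lambda>(i, j). if j = k then h $ i / w $ k else 0)" for h :: "'a vec"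
  have Ec: "E h \<in> carrier_mat a n" for h by (simp add: E_def)
  have Ew: "E h *\<^sub>v w = h" if "h \<in> carrier_vec a" for h
  proof (rule eq_vecI)
    fix i assume i: "i < dim_vec h"
    have "(E h *\<^sub>v w) $ i = (\<Sum>j<n. (if j = k then h $ i / w $ k else 0) * w $ j)"
      using i that w by (simp add: E_def scalar_prod_def lessThan_atLeast0)
    also have "\<dots> = (\<Sum>j<n. if j = k then h $ i else 0)"
      using k by (intro sum.cong) auto
    finally show "(E h *\<^sub>v w) $ i = h $ i" using k by simp
  qed (use that in \<open>simp add: E_def\<close>)
  let ?K = "{H \<in> carrier_mat a n. H *\<^sub>v w = 0\<^sub>v a}"
  have val: "(H + E h) *\<^sub>v w = h" if "H \<in> ?K" "h \<in> carrier_vec a" for H h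
    using that w Ec[of h] Ew[of h] by (simp add: add_mult_distrib_mat_vec[of _ a n])
  have "card (?K \<times> (carrier_vec a :: 'a vec set)) \<le> card (carrier_mat a n :: 'a mat set)"
  proof (rule card_inj_on_le[where f = "\<lambda>(H, h). H + E h"])
    show "inj_on (\<lambda>(H, h). H + E h) (?K \<times> (carrier_vec a :: 'a vec set))"
    proof (intro inj_onI)
      fix p p' assume p: "p \<in> ?K \<times> (carrier_vec a :: 'a vec set)" "p' \<in> ?K \<times> (carrier_vec a :: 'a vec set)"
        and eq: "(case p of (H, h) \<Rightarrow> H + E h) = (case p' of (H, h) \<Rightarrow> H + E h)"
      obtain H h H' h' where pp: "p = (H, h)" "p' = (H', h')" by (cases p, cases p')
      have h: "h = h'" using val[of H h] val[of H' h'] p eq by (simp add: pp)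
      have canc: "(A + E h) - E h = A" if "A \<in> carrier_mat a n" for A
        using that Ec by (rule add_diff_cancel_mat(1))
      have "H + E h = H' + E h" using eq h by (simp add: pp)
      then have "H = H'" using canc[of H] canc[of H'] p pp by (metis (no_types, lifting) mem_Collect_eq mem_Sigma_iff)
      then show "p = p'" using h pp by simp
    qed
    show "(\<lambda>(H, h). H + E h) ` (?K \<times> (carrier_vec a :: 'a vec set)) \<subseteq> carrier_mat a n"
      using Ec by (intro image_subsetI) (simp add: case_prod_unfold)
  qed simp
  then show ?thesis by (simp add: card_cartesian_product card_carrier_vec card_carrier_mat)
qed

lemma linear_hash_collisions:
  fixes x y :: "'a::{field,finite} vec"
  assumes "x \<in> carrier_vec n" "y \<in> carrier_vec n" "x \<noteq> y"
  shows "card {H \<in> carrier_mat a n. H *\<^sub>v x = H *\<^sub>v y} * CARD('a) ^ a \<le> CARD('a) ^ (a * n)"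
proof -
  have nz: "x - y \<noteq> 0\<^sub>v n"
  proof
    assume "x - y = 0\<^sub>v n"
    then have "(x - y) $ i = 0" if "i < n" for i
      using that by simp
    then have "x $ i = y $ i" if "i < n" for i
      using that assms by simp
    then have "x = y" using assms by (intro eq_vecI) auto
    then show False using assms by simp
  qed
  have "{H \<in> carrier_mat a n. H *\<^sub>v x = H *\<^sub>v y} \<subseteq> {H \<in> carrier_mat a n. H *\<^sub>v (x - y) = 0\<^sub>v a}"
  proof clarify
    fix H :: "'a mat" assume H: "H \<in> carrier_mat a n" "H *\<^sub>v x = H *\<^sub>v y"
    have "H *\<^sub>v (x - y) = H *\<^sub>v y - H *\<^sub>v y"
      using H assms by (simp add: mult_minus_distrib_mat_vec[of H a n])
    also have "\<dots> = 0\<^sub>v a"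
      using H assms by (intro eq_vecI) auto
    finally show "H *\<^sub>v (x - y) = 0\<^sub>v a" .
  qed
  then have "card {H \<in> carrier_mat a n. H *\<^sub>v x = H *\<^sub>v y} \<le> card {H \<in> carrier_mat a n. H *\<^sub>v (x - y) = 0\<^sub>v a}"
    by (rule card_mono[rotated]) simp
  then have "card {H \<in> carrier_mat a n. H *\<^sub>v x = H *\<^sub>v y} * CARD('a) ^ a \<le>
      card {H \<in> carrier_mat a n. H *\<^sub>v (x - y) = 0\<^sub>v a} * CARD('a) ^ a"
    by (rule mult_right_mono) simp
  also have "\<dots> \<le> CARD('a) ^ (a * n)"
    using nz assms by (intro card_matrices_vanishing_at) auto
  finally show ?thesis .
qed

section \<open>Few linear maps are far from uniform\<close>

text \<open>
  The inequality is weak so that, for \<open>\<tau> \<le> 1\<close>, maps with an empty fibre are included.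
\<close>

definition far_from_uniform :: "nat \<Rightarrow> nat \<Rightarrow> 'a::{field,finite} vec set \<Rightarrow> real \<Rightarrow> 'a mat set" where
  "far_from_uniform b n S \<tau> = {L \<in> carrier_mat b n. \<exists>z\<in>carrier_vec b.
     \<tau> * mean_fibre b S \<le> \<bar>real (card {x \<in> S. L *\<^sub>v x = z}) - mean_fibre b S\<bar>}"

definition off_cells :: "nat \<Rightarrow> nat \<Rightarrow> 'a::{field,finite} vec set \<Rightarrow> real \<Rightarrow> 'a mat \<times> 'a mat \<Rightarrow> ('a vec \<times> 'a vec) set" where
  "off_cells a b S \<tau> M = {v \<in> carrier_vec a \<times> carrier_vec b.
     \<tau> * mean_fibre (a + b) S / 2 \<le> \<bar>real (card {x \<in> S. (fst M *\<^sub>v x, snd M *\<^sub>v x) = v}) - mean_fibre (a + b) S\<bar>}"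

lemma sum_card_off_cells:
  fixes S :: "'a::{field,finite} vec set"
  assumes S: "S \<subseteq> carrier_vec n" "S \<noteq> {}" and \<tau>: "0 < \<tau>"
  shows "(\<Sum>M\<in>carrier_mat a n \<times> carrier_mat b n. real (card (off_cells a b S \<tau> M))) * (\<tau>\<^sup>2 * mean_fibre (a + b) S)
      \<le> 4 * real CARD('a) ^ (a + b) * real CARD('a) ^ ((a + b) * n)"
proof -
  let ?\<Omega> = "carrier_mat a n \<times> carrier_mat b n :: ('a mat \<times> 'a mat) set"
  let ?V = "carrier_vec a \<times> carrier_vec b :: ('a vec \<times> 'a vec) set"
  let ?h = "\<lambda>M x. (fst M *\<^sub>v x, snd M *\<^sub>v x)"
  define \<nu> where "\<nu> = mean_fibre (a + b) S"
  have finS: "finite S" by (rule finite_subset[OF S(1)]) simp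
  have cS: "card S > 0" using finS S by (simp add: card_gt_0_iff)
  have V: "card ?V = CARD('a) ^ (a + b)"
    by (simp add: card_cartesian_product card_carrier_vec power_add)
  have \<Omega>: "card ?\<Omega> = CARD('a) ^ ((a + b) * n)"
    by (simp add: card_cartesian_product card_carrier_mat power_add add_mult_distrib)
  have \<nu>: "\<nu> = card S / card ?V" "\<nu> > 0"
    using cS by (simp_all add: \<nu>_def mean_fibre_def V)
  have "(\<Sum>M\<in>?\<Omega>. \<Sum>v\<in>?V. (real (card {x \<in> S. ?h M x = v}) - card S / card ?V)\<^sup>2) \<le> real (card ?\<Omega>) * card S"
  proof (rule universal_hashing_variance)
    show "?V \<noteq> {}" using V by fastforce
    fix x y assume xy: "x \<in> S" "y \<in> S" "x \<noteq> y"
    have "{M \<in> ?\<Omega>. ?h M x = ?h M y} = {H \<in> carrier_mat a n. H *\<^sub>v x = H *\<^sub>v y} \<times> {Y \<in> carrier_mat b n. Y *\<^sub>v x = Y *\<^sub>v y}"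
      by auto
    then have "card {M \<in> ?\<Omega>. ?h M x = ?h M y} * card ?V =
        (card {H \<in> carrier_mat a n. H *\<^sub>v x = H *\<^sub>v y} * CARD('a) ^ a) *
        (card {Y \<in> carrier_mat b n. Y *\<^sub>v x = Y *\<^sub>v y} * CARD('a) ^ b)"
      by (simp add: card_carrier_vec card_cartesian_product)
    also have "\<dots> \<le> CARD('a) ^ (a * n) * CARD('a) ^ (b * n)"
      using xy S(1) by (intro mult_mono linear_hash_collisions) auto
    finally show "card {M \<in> ?\<Omega>. ?h M x = ?h M y} * card ?V \<le> card ?\<Omega>"
      unfolding \<Omega> by (simp add: power_add add_mult_distrib)
  qed (use finS S(1) in auto)
  then have "(\<Sum>M\<in>?\<Omega>. real (card {v \<in> ?V. \<tau> * \<nu> / 2 \<le> \<bar>real (card {x \<in> S. ?h M x = v}) - card S / card ?V\<bar>})) *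
      (\<tau> * \<nu> / 2)\<^sup>2 \<le> real (card ?\<Omega>) * card S"
    using \<tau> \<nu>(2) by (intro card_deviations) auto
  moreover have "{v \<in> ?V. \<tau> * \<nu> / 2 \<le> \<bar>real (card {x \<in> S. ?h M x = v}) - card S / card ?V\<bar>} = off_cells a b S \<tau> M" for M
    unfolding off_cells_def \<nu>(1)[symmetric] \<nu>_def by (rule refl)
  moreover have "real (card S) = \<nu> * real CARD('a) ^ (a + b)"
    using V by (simp add: \<nu>(1))
  ultimately have "(\<Sum>M\<in>?\<Omega>. real (card (off_cells a b S \<tau> M))) * (\<tau> * \<nu> / 2)\<^sup>2 \<le>
      real CARD('a) ^ ((a + b) * n) * (\<nu> * real CARD('a) ^ (a + b))"
    by (simp add: \<Omega>)
  then have "\<nu> * ((\<Sum>M\<in>?\<Omega>. real (card (off_cells a b S \<tau> M))) * (\<tau>\<^sup>2 * \<nu>)) \<le>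
      \<nu> * (4 * real CARD('a) ^ (a + b) * real CARD('a) ^ ((a + b) * n))"
    by (simp add: power2_eq_square field_simps)
  then show ?thesis
    using \<nu>(2) unfolding \<nu>_def by (rule mult_left_le_imp_le)
qed

definition near_cells :: "nat \<Rightarrow> 'a::{field,finite} vec set \<Rightarrow> real \<Rightarrow> real \<Rightarrow> 'a mat \<Rightarrow> 'a vec set" where
  "near_cells a T \<tau> \<nu> H = {h \<in> carrier_vec a. \<bar>real (card {x \<in> T. H *\<^sub>v x = h}) - \<nu>\<bar> < \<tau> * \<nu> / 2}"

text \<open>
  The set \<open>T\<close> is a fibre of the wrong size, with mean cell size \<open>\<sigma> = card T / q^a\<close>.  A cell with
  size close to \<open>\<nu>\<close> is far from \<open>\<sigma>\<close>, by at least half of \<open>\<bar>\<sigma> - \<nu>\<bar>\<close>, and by Chebyshev there are few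
  such cells.  The variance grows with \<open>\<sigma>\<close>, but for large \<open>\<sigma>\<close> the deviation \<open>\<bar>\<sigma> - \<nu>\<bar>\<close> grows
  as well.
\<close>

lemma sum_card_near_cells:
  fixes T :: "'a::{field,finite} vec set"
  assumes T: "T \<subseteq> carrier_vec n" and \<tau>: "0 < \<tau>" "\<tau> \<le> 1" and \<nu>: "0 < \<nu>"
    and far: "\<tau> * \<nu> \<le> \<bar>card T / real CARD('a) ^ a - \<nu>\<bar>"
  shows "(\<Sum>H\<in>carrier_mat a n. real (card (near_cells a T \<tau> \<nu> H))) * (\<tau>\<^sup>2 * \<nu>)
      \<le> 8 * real CARD('a) ^ a * real CARD('a) ^ (a * n)"
proof -
  let ?\<Omega> = "carrier_mat a n :: 'a mat set" and ?V = "carrier_vec a :: 'a vec set"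
  let ?f = "\<lambda>H h. real (card {x \<in> T. H *\<^sub>v x = h})"
  define Q where "Q = real CARD('a) ^ a"
  define W where "W = real CARD('a) ^ (a * n)"
  define \<sigma> where "\<sigma> = card T / Q"
  define g where "g = \<bar>\<sigma> - \<nu>\<bar>"
  define A where "A = (\<Sum>H\<in>?\<Omega>. real (card (near_cells a T \<tau> \<nu> H)))"
  have Q: "Q > 0" by (simp add: Q_def)
  have W: "W > 0" by (simp add: W_def)
  have g: "\<tau> * \<nu> \<le> g" using far by (simp add: g_def \<sigma>_def Q_def)
  then have gpos: "g > 0" using \<tau> \<nu> by (meson less_le_trans mult_pos_pos)
  have A: "A \<ge> 0" by (simp add: A_def sum_nonneg)
  have finT: "finite T" by (rule finite_subset[OF T]) simp
  have V: "real (card ?V) = Q" by (simp add: card_carrier_vec Q_def)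
  have "(\<Sum>H\<in>?\<Omega>. \<Sum>h\<in>?V. (?f H h - card T / card ?V)\<^sup>2) \<le> real (card ?\<Omega>) * card T"
  proof (rule universal_hashing_variance)
    show "?V \<noteq> {}" using zero_carrier_vec by blast
    fix x y assume "x \<in> T" "y \<in> T" "x \<noteq> y"
    then show "card {H \<in> ?\<Omega>. H *\<^sub>v x = H *\<^sub>v y} * card ?V \<le> card ?\<Omega>"
      unfolding card_carrier_vec card_carrier_mat using T by (intro linear_hash_collisions) auto
  qed (use finT T in auto)
  then have "(\<Sum>H\<in>?\<Omega>. \<Sum>h\<in>?V. (?f H h - \<sigma>)\<^sup>2) \<le> W * (\<sigma> * Q)"
    using Q unfolding V by (simp add: card_carrier_mat W_def \<sigma>_def)
  then have "(\<Sum>H\<in>?\<Omega>. real (card {h \<in> ?V. g / 2 \<le> \<bar>?f H h - \<sigma>\<bar>})) * (g / 2)\<^sup>2 \<le> W * (\<sigma> * Q)"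
    using gpos by (intro card_deviations) auto
  moreover have "A \<le> (\<Sum>H\<in>?\<Omega>. real (card {h \<in> ?V. g / 2 \<le> \<bar>?f H h - \<sigma>\<bar>}))"
    unfolding A_def
  proof (intro sum_mono of_nat_mono card_mono)
    fix H show "near_cells a T \<tau> \<nu> H \<subseteq> {h \<in> ?V. g / 2 \<le> \<bar>?f H h - \<sigma>\<bar>}"
    proof
      fix h assume "h \<in> near_cells a T \<tau> \<nu> H"
      then have h: "h \<in> ?V" "\<bar>?f H h - \<nu>\<bar> < \<tau> * \<nu> / 2" by (auto simp: near_cells_def)
      have "g \<le> \<bar>?f H h - \<sigma>\<bar> + \<bar>?f H h - \<nu>\<bar>" unfolding g_def by linarith
      then have "g / 2 \<le> \<bar>?f H h - \<sigma>\<bar>" using h(2) g by linarith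
      then show "h \<in> {h \<in> ?V. g / 2 \<le> \<bar>?f H h - \<sigma>\<bar>}" using h(1) by blast
    qed
  qed simp
  ultimately have "A * (g / 2)\<^sup>2 \<le> W * (\<sigma> * Q)"
    by (meson mult_right_mono order_trans zero_le_power2)
  then have 1: "A * g\<^sup>2 \<le> 4 * W * Q * \<sigma>" by (simp add: power_divide field_simps)
  \<comment> \<open>the variance is proportional to \<open>\<sigma>\<close>, which the squared deviation dominates\<close>
  have 2: "\<tau>\<^sup>2 * \<nu> * \<sigma> \<le> 2 * g\<^sup>2"
  proof (cases "\<sigma> \<le> 2 * \<nu>")
    case True
    have "\<tau>\<^sup>2 * \<nu> * \<sigma> \<le> \<tau>\<^sup>2 * \<nu> * (2 * \<nu>)"
      using True \<nu> by (intro mult_left_mono) auto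
    also have "\<dots> = 2 * (\<tau> * \<nu>)\<^sup>2" by (simp add: power2_eq_square)
    also have "\<dots> \<le> 2 * g\<^sup>2" using g \<tau> \<nu> by (intro mult_left_mono power_mono) auto
    finally show ?thesis .
  next
    case False
    then have "\<sigma> / 2 \<le> g" using \<nu> unfolding g_def by linarith
    have "\<tau>\<^sup>2 * (\<nu> * \<sigma>) \<le> 1 * (\<nu> * \<sigma>)"
      using \<tau> \<nu> False by (intro mult_right_mono power_le_one) auto
    also have "\<dots> \<le> \<sigma> / 2 * \<sigma>" using False \<nu> by simp
    also have "\<dots> = 2 * (\<sigma> / 2)\<^sup>2" by (simp add: power2_eq_square)
    also have "\<dots> \<le> 2 * g\<^sup>2" using \<open>\<sigma> / 2 \<le> g\<close> False \<nu> by (intro mult_left_mono power_mono) auto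
    finally show ?thesis by (simp add: mult_ac)
  qed
  have "(A * (\<tau>\<^sup>2 * \<nu>)) * g\<^sup>2 = (\<tau>\<^sup>2 * \<nu>) * (A * g\<^sup>2)" by simp
  also have "\<dots> \<le> (\<tau>\<^sup>2 * \<nu>) * (4 * W * Q * \<sigma>)"
    using 1 \<nu> by (intro mult_left_mono) auto
  also have "\<dots> = (4 * W * Q) * (\<tau>\<^sup>2 * \<nu> * \<sigma>)" by simp
  also have "\<dots> \<le> (4 * W * Q) * (2 * g\<^sup>2)"
    using 2 W Q by (intro mult_left_mono) auto
  finally have "(A * (\<tau>\<^sup>2 * \<nu>)) * g\<^sup>2 \<le> (8 * Q * W) * g\<^sup>2" by (simp add: mult_ac)
  then show ?thesis
    unfolding A_def Q_def W_def by (rule mult_right_le_imp_le) (use gpos in simp)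
qed

text \<open>
  Double counting of the triples \<open>(L, H, B)\<close> such that \<open>L\<close> is far and \<open>H\<close> is good for \<open>L\<close>,
  meaning that at least half of the cells into which \<open>H\<close> splits a wrong fibre are wrong.  With
  \<open>K = \<tau>\<^sup>2 \<nu>\<close>, at least the proportion \<open>1 - 16 / K\<close> of the \<open>H\<close> is good for a far \<open>L\<close>.  The map
  \<open>(L, H, B) \<mapsto> (H, L + B H, B)\<close> is injective and makes \<open>B\<close> rich for the wrong cells of
  \<open>(H, L + B H)\<close>, so by the maximal inequality the proportion of such triples is at most
  \<open>40 \<cdot> 4 / K\<close>.  Hence the proportion of far \<open>L\<close> is at most \<open>160 / (K - 16)\<close>, which is less than
  \<open>\<delta>\<close> when \<open>K \<ge> 192 / \<delta>\<close>.
\<close>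

lemma card_far_from_uniform:
  fixes S :: "'a::{field,finite} vec set"
  assumes S: "S \<subseteq> carrier_vec n" "S \<noteq> {}" and \<tau>: "0 < \<tau>" "\<tau> \<le> 1" and ab: "1 \<le> a" "1 \<le> b"
    and large: "16 * (a + b) \<le> CARD('a) ^ (a - 1)"
    and \<delta>: "0 < \<delta>" "\<delta> < 1" and mean: "192 \<le> \<tau>\<^sup>2 * mean_fibre (a + b) S * \<delta>"
  shows "real (card (far_from_uniform b n S \<tau>)) < \<delta> * real CARD('a) ^ (b * n)"
proof -
  let ?E = "far_from_uniform b n S \<tau>"
  let ?Hs = "carrier_mat a n :: 'a mat set" and ?Ls = "carrier_mat b n :: 'a mat set" and ?Bs = "carrier_mat b a :: 'a mat set"
  define \<nu> where "\<nu> = mean_fibre (a + b) S"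
  define q where "q = real CARD('a)"
  have q: "q > 0" by (simp add: q_def)
  define K where "K = \<tau>\<^sup>2 * \<nu>"
  have finS: "finite S" by (rule finite_subset[OF S(1)]) simp
  have "card S > 0" using finS S by (simp add: card_gt_0_iff)
  then have \<nu>: "\<nu> > 0" by (simp add: \<nu>_def mean_fibre_def)
  have K: "K > 0" using \<nu> \<tau> by (simp add: K_def)
  have K\<delta>: "192 \<le> K * \<delta>" using mean by (simp add: K_def \<nu>_def)
  have mean_b: "mean_fibre b S = q ^ a * \<nu>"
    by (simp add: \<nu>_def mean_fibre_def power_add q_def)
  define good where "good L = {H \<in> ?Hs. \<exists>z\<in>carrier_vec b. CARD('a) ^ a \<le> 2 * card {h \<in> carrier_vec a.
      \<tau> * \<nu> / 2 \<le> \<bar>real (card {x \<in> S. H *\<^sub>v x = h \<and> L *\<^sub>v x = z}) - \<nu>\<bar>}}" for L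
  have good_card: "q ^ (a * n) * (K - 16) \<le> card (good L) * K" if L: "L \<in> ?E" for L
  proof -
    obtain z where z: "z \<in> carrier_vec b" "\<tau> * mean_fibre b S \<le> \<bar>real (card {x \<in> S. L *\<^sub>v x = z}) - mean_fibre b S\<bar>"
      using L unfolding far_from_uniform_def by blast
    define T where "T = {x \<in> S. L *\<^sub>v x = z}"
    define N where "N H = near_cells a T \<tau> \<nu> H" for H
    have T: "T \<subseteq> carrier_vec n" using S by (auto simp: T_def)
    have "q ^ a * (\<tau> * \<nu>) \<le> \<bar>q ^ a * (card T / q ^ a - \<nu>)\<bar>"
      using z(2) q unfolding mean_b T_def[symmetric] by (simp add: algebra_simps)
    then have far: "\<tau> * \<nu> \<le> \<bar>card T / q ^ a - \<nu>\<bar>"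
      using q by (simp add: abs_mult)
    have near: "(\<Sum>H\<in>?Hs. real (card (N H))) * K \<le> 8 * q ^ a * q ^ (a * n)"
      using sum_card_near_cells[OF T \<tau> \<nu> far[unfolded q_def]] by (simp add: N_def K_def q_def)
    \<comment> \<open>a map that is not good leaves at least half of the cells near \<open>\<nu>\<close>\<close>
    have ng: "q ^ a \<le> 2 * card (N H)" if H: "H \<in> ?Hs - good L" for H
    proof -
      let ?O = "{h \<in> carrier_vec a. \<tau> * \<nu> / 2 \<le> \<bar>real (card {x \<in> S. H *\<^sub>v x = h \<and> L *\<^sub>v x = z}) - \<nu>\<bar>}"
      have "N H = carrier_vec a - ?O"
        unfolding N_def near_cells_def T_def by (auto simp: not_le conj_ac intro!: arg_cong[of _ _ card])
      then have "card (N H) = CARD('a) ^ a - card ?O"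
        by (simp add: card_Diff_subset card_carrier_vec)
      moreover have "2 * card ?O < CARD('a) ^ a"
        using H z(1) unfolding good_def by (auto simp: not_le)
      ultimately have "CARD('a) ^ a \<le> 2 * card (N H)" by linarith
      then have "real (CARD('a) ^ a) \<le> real (2 * card (N H))" by (rule of_nat_mono)
      then show ?thesis unfolding q_def by simp
    qed
    have gsub: "good L \<subseteq> ?Hs" by (auto simp: good_def)
    have "real (card (?Hs - good L)) * q ^ a = (\<Sum>H\<in>?Hs - good L. q ^ a)" by simp
    also have "\<dots> \<le> (\<Sum>H\<in>?Hs - good L. 2 * real (card (N H)))"
      using ng by (intro sum_mono) simp
    also have "\<dots> \<le> (\<Sum>H\<in>?Hs. 2 * real (card (N H)))"
      by (intro sum_mono2) auto
    also have "\<dots> = 2 * (\<Sum>H\<in>?Hs. real (card (N H)))" by (simp add: sum_distrib_left)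
    finally have "real (card (?Hs - good L)) * q ^ a * K \<le> 2 * (\<Sum>H\<in>?Hs. real (card (N H))) * K"
      using K by (intro mult_right_mono) auto
    also have "\<dots> \<le> 16 * q ^ (a * n) * q ^ a" using near by (simp add: mult_ac)
    finally have "(real (card (?Hs - good L)) * K) * q ^ a \<le> (16 * q ^ (a * n)) * q ^ a" by (simp add: mult_ac)
    then have "real (card (?Hs - good L)) * K \<le> 16 * q ^ (a * n)"
      by (rule mult_right_le_imp_le) (use q in simp)
    moreover have "real (card (?Hs - good L)) = q ^ (a * n) - card (good L)"
      using card_mono[OF finite_carrier_mat gsub]
      by (subst card_Diff_subset[OF finite_subset[OF gsub finite_carrier_mat] gsub])
        (simp add: card_carrier_mat q_def of_nat_diff)
    ultimately show ?thesis by (simp add: algebra_simps)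
  qed
  let ?G = "Sigma ?E (\<lambda>L. good L \<times> ?Bs)"
  let ?R = "Sigma (?Hs \<times> ?Ls) (\<lambda>M. rich_shears a b (off_cells a b S \<tau> M))"
  have Esub: "?E \<subseteq> ?Ls" by (auto simp: far_from_uniform_def)
  have gsub: "good L \<subseteq> ?Hs" for L by (auto simp: good_def)
  have rsub: "rich_shears a b D \<subseteq> ?Bs" for D by (auto simp: rich_shears_def)
  have fin: "finite ?E" "finite (good L)" "finite (rich_shears a b D)" for L and D :: "('a vec \<times> 'a vec) set"
    using finite_subset[OF Esub] finite_subset[OF gsub] finite_subset[OF rsub] by simp_all
  have "card ?G \<le> card ?R"
  proof (rule card_inj_on_le[where f = "\<lambda>(L, H, B). ((H, L + B * H), B)"])
    show "finite ?R" using fin by (intro finite_SigmaI) auto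
    show "inj_on (\<lambda>(L, H, B). ((H, L + B * H), B)) ?G"
    proof (rule inj_onI)
      fix p p' assume p: "p \<in> ?G" "p' \<in> ?G"
        and eq: "(case p of (L, H, B) \<Rightarrow> ((H, L + B * H), B)) = (case p' of (L, H, B) \<Rightarrow> ((H, L + B * H), B))"
      obtain L H B L' H' B' where pp: "p = (L, H, B)" "p' = (L', H', B')"
        by (cases p, cases p')
      have e: "H' = H" "B' = B" "L + B * H = L' + B * H" using eq by (auto simp: pp)
      have c: "L \<in> ?Ls" "L' \<in> ?Ls" "B \<in> ?Bs" "H \<in> ?Hs" using p Esub gsub by (auto simp: pp)
      have canc: "(X + B * H) - B * H = X" if "X \<in> ?Ls" for X
        using that mult_carrier_mat[OF c(3,4)] by (rule add_diff_cancel_mat(1))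
      have "L = L'" using canc[OF c(1)] canc[OF c(2)] e(3) by metis
      then show "p = p'" using e by (simp add: pp)
    qed
    show "(\<lambda>(L, H, B). ((H, L + B * H), B)) ` ?G \<subseteq> ?R"
    proof (intro image_subsetI)
      fix p assume p: "p \<in> ?G"
      obtain L H B where pp: "p = (L, H, B)" by (cases p)
      have c: "L \<in> ?Ls" "H \<in> ?Hs" "B \<in> ?Bs" using p Esub gsub by (auto simp: pp)
      obtain z where z: "z \<in> carrier_vec b" and half: "CARD('a) ^ a \<le> 2 * card {h \<in> carrier_vec a.
          \<tau> * \<nu> / 2 \<le> \<bar>real (card {x \<in> S. H *\<^sub>v x = h \<and> L *\<^sub>v x = z}) - \<nu>\<bar>}"
        using p unfolding pp good_def by blast
      \<comment> \<open>the cells of \<open>(H, L)\<close> over \<open>z\<close> are cells of \<open>(H, L + B H)\<close> on the translate by \<open>z\<close> of the subspace of \<open>B\<close>\<close>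
      have cell: "{x \<in> S. H *\<^sub>v x = h \<and> L *\<^sub>v x = z} = {x \<in> S. (H *\<^sub>v x, (L + B * H) *\<^sub>v x) = (h, z + B *\<^sub>v h)}"
        if h: "h \<in> carrier_vec a" for h
      proof -
        have "L *\<^sub>v x = z \<longleftrightarrow> (L + B * H) *\<^sub>v x = z + B *\<^sub>v h" if "x \<in> S" "H *\<^sub>v x = h" for x
        proof -
          have x: "x \<in> carrier_vec n" using that S by auto
          have "(L + B * H) *\<^sub>v x = L *\<^sub>v x + B *\<^sub>v h"
            using c x that by (simp add: add_mult_distrib_mat_vec[of _ b n] assoc_mult_mat_vec[of _ b a _ n])
          moreover have "u = z" if "u + B *\<^sub>v h = z + B *\<^sub>v h" "u \<in> carrier_vec b" for u
          proof (rule eq_vecI)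
            fix i assume "i < dim_vec z"
            then show "u $ i = z $ i" using arg_cong[OF that(1), of "\<lambda>v. v $ i"] that(2) z c by simp
          qed (use that z in auto)
          moreover have "L *\<^sub>v x \<in> carrier_vec b" using c x by auto
          ultimately show ?thesis by auto
        qed
        then show ?thesis by auto
      qed
      have "B \<in> rich_shears a b (off_cells a b S \<tau> (H, L + B * H))"
        unfolding rich_shears_def
      proof (intro CollectI conjI bexI[of _ z] c z)
        have "{h \<in> carrier_vec a. \<tau> * \<nu> / 2 \<le> \<bar>real (card {x \<in> S. H *\<^sub>v x = h \<and> L *\<^sub>v x = z}) - \<nu>\<bar>} \<subseteq>
           {h \<in> carrier_vec a. (h, z + B *\<^sub>v h) \<in> off_cells a b S \<tau> (H, L + B * H)}"
          using z c unfolding off_cells_def \<nu>_def[symmetric] by (auto simp: cell)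
        then show "CARD('a) ^ a \<le> 2 * card {h \<in> carrier_vec a. (h, z + B *\<^sub>v h) \<in> off_cells a b S \<tau> (H, L + B * H)}"
          using half by (intro order_trans[OF half] mult_left_mono card_mono) auto
      qed
      then show "(case p of (L, H, B) \<Rightarrow> ((H, L + B * H), B)) \<in> ?R"
        using c by (simp add: pp)
    qed
  qed
  moreover have "card ?G = (\<Sum>L\<in>?E. card (good L) * CARD('a) ^ (a * b))"
    using fin by (subst card_SigmaI) (auto simp: card_cartesian_product card_carrier_mat mult.commute[of b a])
  moreover have "card ?R = (\<Sum>M\<in>?Hs \<times> ?Ls. card (rich_shears a b (off_cells a b S \<tau> M)))"
    using fin by (subst card_SigmaI) auto
  ultimately have "(\<Sum>L\<in>?E. card (good L) * CARD('a) ^ (a * b)) \<le>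
      (\<Sum>M\<in>?Hs \<times> ?Ls. card (rich_shears a b (off_cells a b S \<tau> M)))"
    by simp
  then have "real (\<Sum>L\<in>?E. card (good L) * CARD('a) ^ (a * b)) \<le>
      real (\<Sum>M\<in>?Hs \<times> ?Ls. card (rich_shears a b (off_cells a b S \<tau> M)))"
    by (rule of_nat_mono)
  then have GR: "(\<Sum>L\<in>?E. real (card (good L)) * q ^ (a * b)) \<le>
      (\<Sum>M\<in>?Hs \<times> ?Ls. real (card (rich_shears a b (off_cells a b S \<tau> M))))"
    unfolding of_nat_sum of_nat_mult of_nat_power q_def .
  have "real (card ?E) * (q ^ (a * n) * (K - 16)) * q ^ (a * b) = (\<Sum>L\<in>?E. (q ^ (a * n) * (K - 16)) * q ^ (a * b))"
    by simp
  also have "\<dots> \<le> (\<Sum>L\<in>?E. (card (good L) * K) * q ^ (a * b))"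
    using good_card q by (intro sum_mono mult_right_mono) auto
  also have "\<dots> = (\<Sum>L\<in>?E. real (card (good L)) * q ^ (a * b)) * K"
    by (simp add: sum_distrib_right sum_distrib_left mult_ac)
  also have "\<dots> \<le> (\<Sum>M\<in>?Hs \<times> ?Ls. real (card (rich_shears a b (off_cells a b S \<tau> M)))) * K"
    using GR K by (intro mult_right_mono) auto
  finally have step1: "real (card ?E) * (q ^ (a * n) * (K - 16)) * q ^ (a * b) \<le>
     (\<Sum>M\<in>?Hs \<times> ?Ls. real (card (rich_shears a b (off_cells a b S \<tau> M)))) * K" .
  have "(\<Sum>M\<in>?Hs \<times> ?Ls. real (card (rich_shears a b (off_cells a b S \<tau> M)))) * q ^ (a + b) \<le>
     (\<Sum>M\<in>?Hs \<times> ?Ls. real (card (off_cells a b S \<tau> M)) * (40 * q ^ (a * b)))"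
    unfolding sum_distrib_right
  proof (intro sum_mono)
    fix M
    have "card (rich_shears a b (off_cells a b S \<tau> M)) * CARD('a) ^ (a + b) \<le> 40 * card (off_cells a b S \<tau> M) * CARD('a) ^ (a * b)"
      by (rule kakeya_maximal_shears[OF _ ab large]) (auto simp: off_cells_def)
    then have "real (card (rich_shears a b (off_cells a b S \<tau> M)) * CARD('a) ^ (a + b)) \<le> real (40 * card (off_cells a b S \<tau> M) * CARD('a) ^ (a * b))"
      by (rule of_nat_mono)
    then show "real (card (rich_shears a b (off_cells a b S \<tau> M))) * q ^ (a + b) \<le> real (card (off_cells a b S \<tau> M)) * (40 * q ^ (a * b))"
      by (simp add: q_def mult_ac)
  qed
  then have "(\<Sum>M\<in>?Hs \<times> ?Ls. real (card (rich_shears a b (off_cells a b S \<tau> M)))) * q ^ (a + b) * K \<le>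
     (\<Sum>M\<in>?Hs \<times> ?Ls. real (card (off_cells a b S \<tau> M)) * (40 * q ^ (a * b))) * K"
    using K by (intro mult_right_mono) auto
  also have "\<dots> = ((\<Sum>M\<in>?Hs \<times> ?Ls. real (card (off_cells a b S \<tau> M))) * K) * (40 * q ^ (a * b))"
    by (simp add: sum_distrib_right sum_distrib_left mult_ac)
  also have "\<dots> \<le> (4 * q ^ (a + b) * q ^ ((a + b) * n)) * (40 * q ^ (a * b))"
    using sum_card_off_cells[OF S \<tau>(1), of a b] q
    by (intro mult_right_mono) (auto simp: K_def \<nu>_def q_def)
  moreover have qN: "q ^ ((a + b) * n) = q ^ (a * n) * q ^ (b * n)"
    by (simp add: add_mult_distrib power_add)
  ultimately have step2: "(\<Sum>M\<in>?Hs \<times> ?Ls. real (card (rich_shears a b (off_cells a b S \<tau> M)))) * K * q ^ (a + b) \<le>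
     (160 * q ^ (a * n) * q ^ (b * n) * q ^ (a * b)) * q ^ (a + b)"
    by (simp add: mult_ac qN)
  have "(\<Sum>M\<in>?Hs \<times> ?Ls. real (card (rich_shears a b (off_cells a b S \<tau> M)))) * K \<le>
     160 * q ^ (a * n) * q ^ (b * n) * q ^ (a * b)"
    using step2 by (rule mult_right_le_imp_le) (use q in simp)
  with step1 have "(real (card ?E) * (K - 16)) * (q ^ (a * n) * q ^ (a * b)) \<le> (160 * q ^ (b * n)) * (q ^ (a * n) * q ^ (a * b))"
    by (simp add: mult_ac)
  then have main: "real (card ?E) * (K - 16) \<le> 160 * q ^ (b * n)"
    by (rule mult_right_le_imp_le) (use q in simp)
  have K192: "K > 192"
    using K\<delta> mult_strict_left_mono[OF \<delta>(2) K] by simp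
  have "160 < \<delta> * (K - 16)"
    using K\<delta> \<delta> by (simp add: algebra_simps)
  then have "160 * q ^ (b * n) < (\<delta> * q ^ (b * n)) * (K - 16)"
    using q by (simp add: mult_ac)
  with main have "real (card ?E) * (K - 16) < (\<delta> * q ^ (b * n)) * (K - 16)" by linarith
  then show ?thesis
    using K192 by (simp add: q_def)
qed

section \<open>Balanced linear maps\<close>

lemma unbalanced_far:
  assumes "A \<in> carrier_mat b n" "\<not> balanced b S \<tau> A"
  shows "A \<in> far_from_uniform b n S \<tau>"
proof -
  have "S \<inter> {x. A *\<^sub>v x = y} = {x \<in> S. A *\<^sub>v x = y}" for y by auto
  with assms obtain y where y: "y \<in> carrier_vec b"
    and "\<not> ((1 - \<tau>) * mean_fibre b S \<le> real (card {x \<in> S. A *\<^sub>v x = y}) \<and>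
        real (card {x \<in> S. A *\<^sub>v x = y}) \<le> (1 + \<tau>) * mean_fibre b S)"
    unfolding balanced_def by auto
  then have "\<tau> * mean_fibre b S \<le> \<bar>real (card {x \<in> S. A *\<^sub>v x = y}) - mean_fibre b S\<bar>"
    by (auto simp: algebra_simps)
  then show ?thesis using assms(1) y unfolding far_from_uniform_def by blast
qed

lemma not_surjective_far:
  assumes "A \<in> carrier_mat b n" "A \<notin> surjections b n" "S \<subseteq> carrier_vec n" "\<tau> \<le> 1"
  shows "A \<in> far_from_uniform b n S \<tau>"
proof -
  have "(\<lambda>x. A *\<^sub>v x) ` carrier_vec n \<subseteq> carrier_vec b" using assms(1) by auto
  with assms(1,2) obtain z where z: "z \<in> carrier_vec b" "z \<notin> (\<lambda>x. A *\<^sub>v x) ` carrier_vec n"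
    unfolding surjections_def by auto
  then have "{x \<in> S. A *\<^sub>v x = z} = {}" using assms(3) by auto
  moreover have "0 \<le> mean_fibre b S" by (simp add: mean_fibre_def)
  moreover from this have "\<tau> * mean_fibre b S \<le> 1 * mean_fibre b S"
    using assms(4) by (rule mult_right_mono[rotated])
  ultimately have "\<tau> * mean_fibre b S \<le> \<bar>real (card {x \<in> S. A *\<^sub>v x = z}) - mean_fibre b S\<bar>"
    by (simp only: card.empty of_nat_0)
  then show ?thesis
    using assms(1) z(1) unfolding far_from_uniform_def by blast
qed

text \<open>
  All maps that are not surjective are far, so restricting to surjections subtracts the same
  number from the numerator and the denominator of a proportion below \<open>\<delta>\<close>.
\<close>

lemma balanced_of_large_mean:
  fixes S :: "'a::{field,finite} vec set"
  assumes S: "S \<subseteq> carrier_vec n" "S \<noteq> {}" and b: "1 \<le> b" and \<tau>: "0 < \<tau>" "\<tau> \<le> 1" and \<delta>: "0 < \<delta>" "\<delta> < 1"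
    and a: "1 \<le> a" "real CARD('a) ^ (a - 1) \<ge> 16 * (real b + real a)"
    and mean: "mean_fibre b S \<ge> 192 * real CARD('a) ^ a / (\<tau>\<^sup>2 * \<delta>)"
  shows "unbalanced_proportion n S b \<tau> < \<delta> \<and>
    measure_pmf.prob (pmf_of_set (carrier_mat b n)) {A. \<not> balanced b S \<tau> A} < \<delta>"
proof -
  let ?E = "far_from_uniform b n S \<tau>" and ?M = "carrier_mat b n :: 'a mat set" and ?J = "surjections b n :: 'a mat set"
  have "real (16 * (a + b)) \<le> real (CARD('a) ^ (a - 1))" using a(2) by simp
  then have large: "16 * (a + b) \<le> CARD('a) ^ (a - 1)" unfolding of_nat_le_iff .
  have "mean_fibre b S = real CARD('a) ^ a * mean_fibre (a + b) S"
    by (simp add: mean_fibre_def power_add)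
  then have "192 \<le> \<tau>\<^sup>2 * mean_fibre (a + b) S * \<delta>"
    using mean \<tau> \<delta> by (simp add: field_simps)
  then have E: "real (card ?E) < \<delta> * real (card ?M)"
    using card_far_from_uniform[OF S \<tau> a(1) b large \<delta>] by (simp add: card_carrier_mat)
  have Esub: "?E \<subseteq> ?M" by (auto simp: far_from_uniform_def)
  have Jsub: "?J \<subseteq> ?M" by (auto simp: surjections_def)
  have M: "real (card ?M) > 0" by (simp add: card_carrier_mat)
  have fin: "finite ?E" "finite ?J" using finite_subset[OF Esub] finite_subset[OF Jsub] by simp_all
  have ne: "?M \<noteq> {}" using M by auto
  have "measure_pmf.prob (pmf_of_set ?M) {A. \<not> balanced b S \<tau> A} = card (?M \<inter> {A. \<not> balanced b S \<tau> A}) / card ?M"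
    using ne by (simp add: measure_pmf_of_set)
  also have "\<dots> \<le> card ?E / card ?M"
    using fin unbalanced_far by (intro divide_right_mono of_nat_mono card_mono) auto
  also have "\<dots> < \<delta>" using E M by (simp add: divide_less_eq)
  finally have prob: "measure_pmf.prob (pmf_of_set ?M) {A. \<not> balanced b S \<tau> A} < \<delta>" .
  have "?M - ?J \<subseteq> ?E" using not_surjective_far[OF _ _ S(1) \<tau>(2)] by auto
  have U: "{A \<in> ?J. \<not> balanced b S \<tau> A} \<subseteq> ?E - (?M - ?J)"
    using Jsub unbalanced_far[of _ b n S \<tau>] by blast
  have cJ: "real (card (?M - ?J)) = real (card ?M) - card ?J"
    using card_mono[OF finite_carrier_mat Jsub] by (simp add: card_Diff_subset[OF fin(2) Jsub] of_nat_diff)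
  have "card {A \<in> ?J. \<not> balanced b S \<tau> A} \<le> card (?E - (?M - ?J))"
    using U fin by (intro card_mono) auto
  also have "\<dots> = card ?E - card (?M - ?J)"
    using \<open>?M - ?J \<subseteq> ?E\<close> by (intro card_Diff_subset) auto
  finally have "real (card {A \<in> ?J. \<not> balanced b S \<tau> A}) \<le> real (card ?E) - real (card (?M - ?J))"
    using card_mono[OF fin(1) \<open>?M - ?J \<subseteq> ?E\<close>] by linarith
  also have "\<dots> < \<delta> * real (card ?M) - \<delta> * real (card (?M - ?J))"
    using E mult_right_mono[of \<delta> 1 "real (card (?M - ?J))"] \<delta> by simp
  also have "\<dots> = \<delta> * card ?J" by (simp add: cJ algebra_simps)
  finally have less: "real (card {A \<in> ?J. \<not> balanced b S \<tau> A}) < \<delta> * card ?J" .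
  then have "\<delta> * real (card ?J) > 0" by (rule le_less_trans[rotated]) simp
  then have "real (card ?J) > 0" using \<delta> by (simp add: zero_less_mult_iff)
  then have "unbalanced_proportion n S b \<tau> < \<delta>"
    using less unfolding unbalanced_proportion_def by (simp add: divide_less_eq)
  then show ?thesis using prob by blast
qed

text \<open>
  Take \<open>q^j\<close> to be the first power of \<open>q\<close> that is at least \<open>b\<close>, so \<open>q^j \<le> q b\<close>, and
  \<open>a = j + 9\<close>.  Since \<open>j < q^j\<close>, the sum \<open>16 (b + j + 9)\<close> is at most \<open>256 q^j \<le> q^(j + 8)\<close>.
\<close>

lemma ex_extra_dimension:
  fixes q b :: nat
  assumes q: "2 \<le> q" and b: "1 \<le> b"
  shows "\<exists>a\<ge>1. 16 * (b + a) \<le> q ^ (a - 1) \<and> q ^ a \<le> q ^ 10 * b"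
proof -
  define j where "j = (LEAST j. b \<le> q ^ j)"
  have exp: "m < q ^ m" for m using q by (intro less_le_trans[OF less_exp power_mono]) auto
  have j: "b \<le> q ^ j" unfolding j_def by (rule LeastI[of _ b]) (use exp[of b] in simp)
  have j': "q ^ j \<le> q * b"
  proof (cases j)
    case 0
    then show ?thesis using q b by simp
  next
    case (Suc i)
    then have "\<not> b \<le> q ^ i" using not_less_Least[of i "\<lambda>j. b \<le> q ^ j"] by (simp add: j_def)
    then show ?thesis using Suc by simp
  qed
  have "16 * (b + (j + 9)) \<le> 256 * q ^ j"
    using j exp[of j] by simp
  also have "\<dots> \<le> q ^ 8 * q ^ j"
    using power_mono[OF q, of 8] by (intro mult_right_mono) auto
  finally have 1: "16 * (b + (j + 9)) \<le> q ^ (j + 9 - 1)" by (simp add: power_add mult_ac)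
  have "q ^ (j + 9) = q ^ 9 * q ^ j" by (simp add: power_add)
  also have "\<dots> \<le> q ^ 9 * (q * b)" using j' by (rule mult_left_mono) simp
  also have "\<dots> = q ^ 10 * b" by (simp add: numeral_eq_Suc)
  finally show ?thesis using 1 by (intro exI[of _ "j + 9"]) auto
qed

theorem corollary1p4:
  fixes q :: nat
  assumes q: "q = CARD('a::{field,finite})"
  shows
    "(\<forall>(n::nat) (S :: 'a vec set) (b::nat) (\<tau>::real) (\<delta>::real).
        S \<subseteq> carrier_vec n \<longrightarrow> S \<noteq> {} \<longrightarrow> 1 \<le> b \<longrightarrow> b \<le> n \<longrightarrow>
        0 < \<tau> \<longrightarrow> \<tau> \<le> 1 \<longrightarrow> 0 < \<delta> \<longrightarrow> \<delta> < 1 \<longrightarrow>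
        (\<exists>a::nat. 1 \<le> a \<and> real q ^ (a - 1) \<ge> 16 * (real b + real a) \<and>
                  mean_fibre b S \<ge> 192 * real q ^ a / (\<tau>\<^sup>2 * \<delta>)) \<longrightarrow>
        unbalanced_proportion n S b \<tau> < \<delta> \<and>
        measure_pmf.prob (pmf_of_set (carrier_mat b n)) {A. \<not> balanced b S \<tau> A} < \<delta>)
     \<and>
     (\<exists>C>0. \<forall>(n::nat) (S :: 'a vec set) (b::nat) (\<tau>::real) (\<delta>::real).
        S \<subseteq> carrier_vec n \<longrightarrow> S \<noteq> {} \<longrightarrow> 1 \<le> b \<longrightarrow> b \<le> n \<longrightarrow>
        0 < \<tau> \<longrightarrow> \<tau> \<le> 1 \<longrightarrow> 0 < \<delta> \<longrightarrow> \<delta> < 1 \<longrightarrow>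
        mean_fibre b S \<ge> C * real b / (\<tau>\<^sup>2 * \<delta>) \<longrightarrow>
        unbalanced_proportion n S b \<tau> < \<delta> \<and>
        measure_pmf.prob (pmf_of_set (carrier_mat b n)) {A. \<not> balanced b S \<tau> A} < \<delta>)"
proof -
  have q2: "2 \<le> q" using card_mono[of UNIV "{0, 1 :: 'a}"] by (simp add: q)
  let ?C = "192 * real q ^ 10"
  have C: "?C > 0" using q2 by simp
  have extra: "\<exists>a\<ge>1. real q ^ (a - 1) \<ge> 16 * (real b + real a) \<and> \<mu> \<ge> 192 * real q ^ a / (\<tau>\<^sup>2 * \<delta>)"
    if h: "1 \<le> b" "0 < \<tau>" "0 < \<delta>" "\<mu> \<ge> ?C * real b / (\<tau>\<^sup>2 * \<delta>)" for b and \<tau> \<delta> \<mu> :: real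
  proof -
    obtain a where a: "1 \<le> a" "16 * (b + a) \<le> q ^ (a - 1)" "q ^ a \<le> q ^ 10 * b"
      using ex_extra_dimension[OF q2 h(1)] by blast
    note of_nat_mono[OF a(2), where 'a = real] of_nat_mono[OF a(3), where 'a = real]
    then have r: "16 * (real b + real a) \<le> real q ^ (a - 1)" "real q ^ a \<le> real q ^ 10 * real b"
      by simp_all
    have "192 * real q ^ a / (\<tau>\<^sup>2 * \<delta>) \<le> ?C * real b / (\<tau>\<^sup>2 * \<delta>)"
      using r(2) h by (intro divide_right_mono) auto
    then show ?thesis using a(1) r(1) h(4) by (intro exI[of _ a]) auto
  qed
  show ?thesis
  proof (intro conjI exI[of _ ?C] allI impI C)
    fix n b :: nat and S :: "'a vec set" and \<tau> \<delta> :: real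
    assume *: "S \<subseteq> carrier_vec n" "S \<noteq> {}" "1 \<le> b" "b \<le> n" "0 < \<tau>" "\<tau> \<le> 1" "0 < \<delta>" "\<delta> < 1"
    assume "\<exists>a::nat. 1 \<le> a \<and> real q ^ (a - 1) \<ge> 16 * (real b + real a) \<and>
      mean_fibre b S \<ge> 192 * real q ^ a / (\<tau>\<^sup>2 * \<delta>)"
    then show "unbalanced_proportion n S b \<tau> < \<delta>"
      "measure_pmf.prob (pmf_of_set (carrier_mat b n)) {A. \<not> balanced b S \<tau> A} < \<delta>"
      using balanced_of_large_mean[OF *(1,2,3,5,6,7,8), folded q] by blast+
  next
    fix n b :: nat and S :: "'a vec set" and \<tau> \<delta> :: real
    assume *: "S \<subseteq> carrier_vec n" "S \<noteq> {}" "1 \<le> b" "b \<le> n" "0 < \<tau>" "\<tau> \<le> 1" "0 < \<delta>" "\<delta> < 1"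
    assume "mean_fibre b S \<ge> ?C * real b / (\<tau>\<^sup>2 * \<delta>)"
    note extra[OF *(3,5,7) this]
    then show "unbalanced_proportion n S b \<tau> < \<delta>"
      "measure_pmf.prob (pmf_of_set (carrier_mat b n)) {A. \<not> balanced b S \<tau> A} < \<delta>"
      using balanced_of_large_mean[OF *(1,2,3,5,6,7,8), folded q] by blast+
  qed
qed

end
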